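(* Let $(W,S)$ be a Coxeter system with $S$ finite. For $k \geq 0$ let $W^{CFC}_k$ denote the set of cyclically fully commutative elements of $W$ of Coxeter length $k$. Then the generating series $W^{CFC}(x) := \sum_{k \geq 0} |W^{CFC}_k|\, x^k$ is a rational function of $x$.
   Context: A Coxeter system $(W,S)$ consists of a group $W$ generated by a finite set $S$ of involutions subject to the relations $(st)^{m_{st}}=1$ for $s \neq t$ with $m_{st} \in \{2,3,\ldots\}\cup\{\infty\}$ (no relation if $m_{st}=\infty$). Words in the free monoid $S^*$ are called expressions. The Coxeter length $\ell(w)$ is the minimal length of an expression representing $w$; expressions of that length are reduced expressions, and $R(w)$ denotes the set of reduced expressions of $w$. For $m_{st}=2$ the relation $st=ts$ is a commutation relation. An element $w$ is fully commutative (FC) if any two words of $R(w)$ can be linked by a sequence of commutation relations (swapping adjacent letters $s,t$ with $m_{st}=2$). A cyclic shift of a word $s_1\cdots s_n$ is any word $s_k s_{k+1}\cdots s_n s_1 \cdots s_{k-1}$ for $k\in\{1,\ldots,n\}$. An element $w \in W$ is cyclically fully commutative (CFC) if every cyclic shift of every word in $R(w)$ is a reduced expression of some fully commutative element (possibly different from $w$). *)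

theory Defs
  imports "HOL-Library.Extended_Nat" "HOL-Computational_Algebra.Polynomial_FPS"
begin

text \<open>A Coxeter system is given by a finite generating set S and a Coxeter matrix
  m with m s t = m t s \<ge> 2 for s \<noteq> t (value \<infinity> meaning no relation).
  Elements of W are represented as equivalence classes of words over S
  modulo the relations s s = 1 and (s t)^(m s t) = 1.\<close>

definition coxeter_system :: "'a set \<Rightarrow> ('a \<Rightarrow> 'a \<Rightarrow> enat) \<Rightarrow> bool" where
  "coxeter_system S m \<longleftrightarrow> finite S \<and>
     (\<forall>s\<in>S. \<forall>t\<in>S. s \<noteq> t \<longrightarrow> m s t = m t s \<and> 2 \<le> m s t)"

definition relators :: "'a set \<Rightarrow> ('a \<Rightarrow> 'a \<Rightarrow> enat) \<Rightarrow> 'a list set" where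
  "relators S m = {[s, s] | s. s \<in> S} \<union>
     {concat (replicate n [s, t]) | s t n. s \<in> S \<and> t \<in> S \<and> s \<noteq> t \<and> m s t = enat n}"

inductive cox_eq :: "'a set \<Rightarrow> ('a \<Rightarrow> 'a \<Rightarrow> enat) \<Rightarrow> 'a list \<Rightarrow> 'a list \<Rightarrow> bool"
  for S m where
  refl: "cox_eq S m w w"
| ins: "cox_eq S m (u @ v) w \<Longrightarrow> r \<in> relators S m \<Longrightarrow> cox_eq S m (u @ r @ v) w"
| del: "cox_eq S m (u @ r @ v) w \<Longrightarrow> r \<in> relators S m \<Longrightarrow> cox_eq S m (u @ v) w"

inductive comm_eq :: "'a set \<Rightarrow> ('a \<Rightarrow> 'a \<Rightarrow> enat) \<Rightarrow> 'a list \<Rightarrow> 'a list \<Rightarrow> bool"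
  for S m where
  refl: "comm_eq S m w w"
| swap: "comm_eq S m (u @ [s, t] @ v) w \<Longrightarrow> s \<in> S \<Longrightarrow> t \<in> S \<Longrightarrow> s \<noteq> t \<Longrightarrow>
           m s t = 2 \<Longrightarrow> comm_eq S m (u @ [t, s] @ v) w"

definition cox_elem :: "'a set \<Rightarrow> ('a \<Rightarrow> 'a \<Rightarrow> enat) \<Rightarrow> 'a list \<Rightarrow> 'a list set" where
  "cox_elem S m w = {v. set v \<subseteq> S \<and> cox_eq S m w v}"

definition cox_group :: "'a set \<Rightarrow> ('a \<Rightarrow> 'a \<Rightarrow> enat) \<Rightarrow> 'a list set set" where
  "cox_group S m = {cox_elem S m w | w. set w \<subseteq> S}"

definition cox_length :: "'a list set \<Rightarrow> nat" where
  "cox_length X = (LEAST n. \<exists>w\<in>X. length w = n)"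

definition red_words :: "'a list set \<Rightarrow> 'a list set" where
  "red_words X = {w \<in> X. length w = cox_length X}"

definition reduced :: "'a set \<Rightarrow> ('a \<Rightarrow> 'a \<Rightarrow> enat) \<Rightarrow> 'a list \<Rightarrow> bool" where
  "reduced S m w \<longleftrightarrow> set w \<subseteq> S \<and> w \<in> red_words (cox_elem S m w)"

definition fully_commutative :: "'a set \<Rightarrow> ('a \<Rightarrow> 'a \<Rightarrow> enat) \<Rightarrow> 'a list set \<Rightarrow> bool" where
  "fully_commutative S m X \<longleftrightarrow> X \<in> cox_group S m \<and>
     (\<forall>u\<in>red_words X. \<forall>v\<in>red_words X. comm_eq S m u v)"

definition cyc_fully_commutative :: "'a set \<Rightarrow> ('a \<Rightarrow> 'a \<Rightarrow> enat) \<Rightarrow> 'a list set \<Rightarrow> bool" where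
  "cyc_fully_commutative S m X \<longleftrightarrow> X \<in> cox_group S m \<and>
     (\<forall>w\<in>red_words X. \<forall>k<length w.
        reduced S m (rotate k w) \<and> fully_commutative S m (cox_elem S m (rotate k w)))"

definition CFC_k :: "'a set \<Rightarrow> ('a \<Rightarrow> 'a \<Rightarrow> enat) \<Rightarrow> nat \<Rightarrow> 'a list set set" where
  "CFC_k S m k = {X. cyc_fully_commutative S m X \<and> cox_length X = k}"

end

theory Submission
  imports Defs Complex_Main "HOL-Library.Countable_Set"
begin

text \<open>By the exchange condition and the exactness of the orders \<open>m s t\<close> (Stembridge's criterion), a word is
  a reduced word of a fully commutative element iff no word in its commutation class has a factor
  \<open>s s\<close> or a factor \<open>s t s \<dots>\<close> of length \<open>m s t \<ge> 3\<close>. Hence the cyclically fully commutative elements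
  correspond to the commutation classes avoiding finitely many factors cyclically.

  Regular languages closed under commutation are stable under the product of traces, Boolean
  operations and rotation, so the words in those classes form a regular language. Intersecting it
  with the regular language of lexicographic normal forms leaves one word per class, and the
  counting function of a regular language satisfies a linear recurrence.\<close>

section \<open>Regular languages\<close>

text \<open>Commutation closure destroys regularity in general: for commuting \<open>s\<close> and
  \<open>t\<close>, the closure of the powers of \<open>s t\<close> consists of the words over these
  letters with equally many of both. Hence every language that enters a product is closed
  beforehand, and the product of two closed languages is recognised directly, with a set of letters
  as extra memory. Rotation reduces to such products by guessing the residual of the language after
  the part that is rotated to the front. On the group side, the presentation bounds the order of
  \<open>s t\<close> only from above. A smaller order would break the step from two left descents to
  a full braid of length \<open>m s t\<close>; the geometric representation excludes it. The
  exchange condition comes without a model of the group, from the parity of inversion counts of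
  words.\<close>

lemma linear_dependence:
  fixes x :: "'i \<Rightarrow> 'b \<Rightarrow> 'f::field"
  assumes "finite Q" "finite I" "card Q < card I"
  shows "\<exists>c. (\<exists>i\<in>I. c i \<noteq> 0) \<and> (\<forall>K\<in>Q. (\<Sum>i\<in>I. c i * x i K) = 0)"
  using assms
proof (induction Q arbitrary: I x rule: finite_induct)
  case empty
  then obtain i where "i \<in> I" by fastforce
  then show ?case by (intro exI[of _ "\<lambda>_. 1"]) auto
next
  case (insert K Q)
  show ?case
  proof (cases "\<forall>i\<in>I. x i K = 0")
    case True
    have "card Q < card I" using insert by simp
    then obtain c where "\<exists>i\<in>I. c i \<noteq> 0" "\<forall>L\<in>Q. (\<Sum>i\<in>I. c i * x i L) = 0"
      using insert.IH[OF \<open>finite I\<close>, of x] by blast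
    moreover have "(\<Sum>i\<in>I. c i * x i K) = 0" using True by (intro sum.neutral) auto
    ultimately show ?thesis by auto
  next
    case False
    then obtain j where j: "j \<in> I" "x j K \<noteq> 0" by blast
    let ?I = "I - {j}"
    \<comment> \<open>Gaussian elimination: the pivot \<open>x j K\<close> clears coordinate
      \<open>K\<close> from all vectors, and \<open>d\<close> recovers the coefficient of
      \<open>j\<close> afterwards.\<close>
    define y where "y i L = x i L - x i K / x j K * x j L" for i L
    have "card Q < card ?I" using insert j by simp
    then obtain c where c: "\<exists>i\<in>?I. c i \<noteq> 0" "\<And>L. L \<in> Q \<Longrightarrow> (\<Sum>i\<in>?I. c i * y i L) = 0"
      using insert.IH[of ?I y] insert.prems(1) by auto
    define d where "d = c(j := - (\<Sum>i\<in>?I. c i * x i K) / x j K)"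
    have sum_y: "(\<Sum>i\<in>I. d i * x i L) = (\<Sum>i\<in>?I. c i * y i L)" for L
    proof -
      have "(\<Sum>i\<in>I. d i * x i L) = d j * x j L + (\<Sum>i\<in>?I. d i * x i L)"
        using j insert.prems by (simp add: sum.remove)
      also have "(\<Sum>i\<in>?I. d i * x i L) = (\<Sum>i\<in>?I. c i * x i L)"
        by (intro sum.cong) (auto simp: d_def)
      also have "d j * x j L = - (\<Sum>i\<in>?I. c i * (x i K / x j K * x j L))"
        by (simp add: d_def sum_distrib_right sum_divide_distrib mult.assoc)
      finally show ?thesis by (simp add: y_def algebra_simps sum_subtractf)
    qed
    have "y i K = 0" for i using j by (simp add: y_def)
    then have "(\<Sum>i\<in>I. d i * x i L) = 0" if "L \<in> insert K Q" for L
      using that c(2) unfolding sum_y by auto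
    moreover have "\<exists>i\<in>I. d i \<noteq> 0" using c(1) by (auto simp: d_def)
    ultimately show ?thesis by blast
  qed
qed

lemma linear_recurrence_imp_rational:
  fixes a :: "nat \<Rightarrow> 'f::field"
  assumes rec: "\<And>k. (\<Sum>i\<le>d. c i * a (i + k)) = 0" and nz: "\<exists>i\<le>d. c i \<noteq> 0"
  shows "\<exists>p q. q \<noteq> 0 \<and> fps_of_poly q * Abs_fps a = fps_of_poly p"
proof -
  \<comment> \<open>The recurrence polynomial reversed: for \<open>n >= d\<close>, coefficient
    \<open>n\<close> of the product with \<open>Abs_fps a\<close> is the recurrence at shift
    \<open>n - d\<close>.\<close>
  define q where "q = (\<Sum>i\<le>d. monom (c i) (d - i))"
  have q: "coeff q j = (if j \<le> d then c (d - j) else 0)" for j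
  proof -
    have "coeff q j = (\<Sum>i\<le>d. if i = d - j \<and> j \<le> d then c i else 0)"
      unfolding q_def coeff_sum by (intro sum.cong) auto
    also have "\<dots> = (if j \<le> d then c (d - j) else 0)" by simp
    finally show ?thesis .
  qed
  obtain i where i: "i \<le> d" "c i \<noteq> 0" using nz by blast
  have "coeff q (d - i) \<noteq> 0" using i by (simp add: q)
  then have "q \<noteq> 0" by auto
  let ?F = "fps_of_poly q * Abs_fps a"
  have zero: "fps_nth ?F n = 0" if "n \<ge> d" for n
  proof -
    have "fps_nth ?F n = (\<Sum>j\<le>n. coeff q j * a (n - j))"
      by (simp add: fps_mult_nth atLeast0AtMost)
    also have "\<dots> = (\<Sum>j\<le>d. coeff q j * a (n - j))"
      using that by (intro sum.mono_neutral_right) (auto simp: q)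
    also have "\<dots> = (\<Sum>i\<le>d. c i * a (i + (n - d)))"
      by (rule sum.reindex_bij_witness[of _ "\<lambda>i. d - i" "\<lambda>i. d - i"]) (use that in \<open>auto simp: q\<close>)
    finally show ?thesis using rec by simp
  qed
  have "?F = fps_of_poly (\<Sum>i<d. monom (fps_nth ?F i) i)"
  proof (rule fps_ext)
    fix n
    have "coeff (\<Sum>i<d. monom (fps_nth ?F i) i) n = (\<Sum>i<d. if i = n then fps_nth ?F i else 0)"
      unfolding coeff_sum by (intro sum.cong) auto
    also have "\<dots> = fps_nth ?F n" using zero[of n] by auto
    finally show "fps_nth ?F n = fps_nth (fps_of_poly (\<Sum>i<d. monom (fps_nth ?F i) i)) n" by simp
  qed
  with \<open>q \<noteq> 0\<close> show ?thesis by blast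
qed

section \<open>Left quotients and closure properties of regular languages\<close>

definition residual :: "'a list set \<Rightarrow> 'a list \<Rightarrow> 'a list set" where
  "residual L u = {v. u @ v \<in> L}"

text \<open>The Myhill-Nerode form of regularity, which avoids automata. Only quotients by words
  over \<open>S\<close> count; \<open>L\<close> itself may contain other words, so plain complements
  are allowed.\<close>

definition regular :: "'a set \<Rightarrow> 'a list set \<Rightarrow> bool" where
  "regular S L \<longleftrightarrow> finite (residual L ` lists S)"

lemma residual_append: "residual L (u @ v) = residual (residual L u) v"
  by (simp add: residual_def)

lemma regularI:
  assumes "finite F" "\<And>u. set u \<subseteq> S \<Longrightarrow> \<exists>x\<in>F. residual L u = f x"
  shows "regular S L"
  unfolding regular_def
proof (rule finite_subset)
  show "residual L ` lists S \<subseteq> f ` F" using assms(2) by (fastforce simp: lists_eq_set)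
qed (use assms(1) in simp)

lemma regular_Int:
  assumes "regular S A" "regular S B"
  shows "regular S (A \<inter> B)"
proof (rule regularI)
  show "finite (residual A ` lists S \<times> residual B ` lists S)"
    using assms by (simp add: regular_def)
  show "\<exists>x\<in>residual A ` lists S \<times> residual B ` lists S. residual (A \<inter> B) u = (\<lambda>(X, Y). X \<inter> Y) x"
    if "set u \<subseteq> S" for u
    using that by (intro bexI[of _ "(residual A u, residual B u)"]) (auto simp: residual_def)
qed

lemma regular_Compl:
  assumes "regular S A"
  shows "regular S (- A)"
proof (rule regularI)
  show "finite (residual A ` lists S)"
    using assms by (simp add: regular_def)
  show "\<exists>X\<in>residual A ` lists S. residual (- A) u = - X" if "set u \<subseteq> S" for u
    using that by (intro bexI[of _ "residual A u"]) (auto simp: residual_def)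
qed

lemma regular_UN:
  assumes "finite I" "\<And>i. i \<in> I \<Longrightarrow> regular S (A i)"
  shows "regular S (\<Union>i\<in>I. A i)"
  using assms
proof (induction I rule: finite_induct)
  case empty
  show ?case by (rule regularI[of "{{}}" _ _ id]) (auto simp: residual_def)
next
  case (insert i I)
  have "regular S (- (- A i \<inter> - (\<Union>i\<in>I. A i)))"
    using insert by (intro regular_Compl regular_Int) auto
  then show ?case by simp
qed

lemma regular_lists: "regular S (lists S)"
  by (rule regularI[of "{lists S}" _ _ id]) (auto simp: residual_def)

lemma regular_finite:
  assumes "finite A"
  shows "regular S A"
proof (rule regularI)
  let ?suffixes = "\<Union>w\<in>A. (\<lambda>k. drop k w) ` {..length w}"
  show "finite (Pow ?suffixes)" using assms by simp
  show "\<exists>X\<in>Pow ?suffixes. residual A u = id X" for u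
  proof (rule bexI[of _ "residual A u"])
    show "residual A u \<in> Pow ?suffixes"
    proof (clarsimp simp: residual_def)
      fix v assume "u @ v \<in> A"
      then show "\<exists>w\<in>A. v \<in> (\<lambda>k. drop k w) ` {..length w}"
        by (intro bexI[of _ "u @ v"] image_eqI[of _ _ "length u"]) auto
    qed
  qed simp
qed

lemma regular_residual:
  assumes "regular S A" "set u \<subseteq> S"
  shows "regular S (residual A u)"
  unfolding regular_def
  by (rule finite_subset[of _ "residual A ` lists S"])
     (use assms in \<open>auto simp: regular_def residual_append[symmetric] lists_eq_set\<close>)

lemma regular_residual_eq:
  assumes "regular S A"
  shows "regular S {v. residual A v = R}"
proof (rule regularI)
  show "finite (residual A ` lists S)"
    using assms by (simp add: regular_def)
  show "\<exists>X\<in>residual A ` lists S. residual {v. residual A v = R} u = {v. residual X v = R}"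
    if "set u \<subseteq> S" for u
    by (rule bexI[of _ "residual A u"])
       (use that in \<open>auto simp: residual_append residual_def[of "{v. _ v}"]\<close>)
qed

text \<open>Cayley-Hamilton without matrices: the counts for all residuals form a vector that
  evolves by a fixed linear map as the length grows. Of these vectors, \<open>card Q + 1\<close> are
  always dependent, and the linear map carries the dependence to all shifts.\<close>

lemma regular_imp_rational_count:
  assumes "finite S" "regular S L"
  shows "\<exists>p q :: 'f::field_char_0 poly. q \<noteq> 0 \<and>
    fps_of_poly q * Abs_fps (\<lambda>k. of_nat (card {w \<in> L. set w \<subseteq> S \<and> length w = k})) = fps_of_poly p"
proof -
  define Q where "Q = residual L ` lists S"
  define a :: "nat \<Rightarrow> 'a list set \<Rightarrow> 'f"
    where "a k K = of_nat (card {w \<in> K. set w \<subseteq> S \<and> length w = k})" for k K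
  have fin: "finite {w \<in> K. set w \<subseteq> S \<and> length w = k}" for k K
    by (rule finite_subset[OF _ finite_lists_length_eq[OF \<open>finite S\<close>, of k]]) auto
  have step: "a (Suc k) K = (\<Sum>s\<in>S. a k (residual K [s]))" for k K
  proof -
    let ?W = "\<lambda>K k. {w \<in> K. set w \<subseteq> S \<and> length w = k}"
    have "?W K (Suc k) = (\<Union>s\<in>S. (#) s ` ?W (residual K [s]) k)"
      by (auto simp: residual_def length_Suc_conv image_iff)
    also have "card \<dots> = (\<Sum>s\<in>S. card ((#) s ` ?W (residual K [s]) k))"
      by (rule card_UN_disjoint) (use assms(1) fin in auto)
    also have "\<dots> = (\<Sum>s\<in>S. card (?W (residual K [s]) k))"
      by (intro sum.cong card_image) auto
    finally show ?thesis by (simp add: a_def)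
  qed
  have closed: "residual K [s] \<in> Q" if K: "K \<in> Q" and "s \<in> S" for K s
  proof -
    obtain u where "K = residual L u" "set u \<subseteq> S" using K by (auto simp: Q_def lists_eq_set)
    then show ?thesis
      using that by (auto simp: Q_def residual_append[symmetric] lists_eq_set)
  qed
  have "finite Q" using assms by (simp add: Q_def regular_def)
  then obtain c where nz: "\<exists>i\<in>{..card Q}. c i \<noteq> 0"
    and dep: "\<And>K. K \<in> Q \<Longrightarrow> (\<Sum>i\<le>card Q. c i * a i K) = 0"
    using linear_dependence[of Q "{..card Q}" a] by auto
  have rec: "(\<Sum>i\<le>card Q. c i * a (i + k) K) = 0" if "K \<in> Q" for k K
    using that
  proof (induction k arbitrary: K)
    case (Suc k)
    have "(\<Sum>i\<le>card Q. c i * a (i + Suc k) K)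
        = (\<Sum>s\<in>S. \<Sum>i\<le>card Q. c i * a (i + k) (residual K [s]))"
      by (subst sum.swap) (simp add: step sum_distrib_left)
    also have "\<dots> = 0" using Suc closed by (intro sum.neutral) auto
    finally show ?case .
  qed (use dep in simp)
  have "residual L [] \<in> Q" by (simp add: Q_def)
  then have "L \<in> Q" by (simp add: residual_def)
  then show ?thesis
    using linear_recurrence_imp_rational[of c "\<lambda>k. a k L" "card Q"] rec nz by (auto simp: a_def)
qed

section \<open>The exchange condition\<close>

fun alt :: "nat \<Rightarrow> 'a \<Rightarrow> 'a \<Rightarrow> 'a list" where
  "alt 0 s t = []"
| "alt (Suc n) s t = s # alt n t s"

lemma length_alt [simp]: "length (alt n s t) = n"
  by (induction n s t rule: alt.induct) auto

lemma set_alt: "set (alt n s t) \<subseteq> {s, t}"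
  by (induction n s t rule: alt.induct) auto

lemma alt_add: "alt (k + n) s t = alt k s t @ (if even k then alt n s t else alt n t s)"
  by (induction k s t rule: alt.induct) auto

lemma alt_even: "alt (2 * n) s t = concat (replicate n [s, t])"
  by (induction n) auto

lemma rev_alt: "rev (alt n s t) = (if even n then alt n t s else alt n s t)"
proof (induction n arbitrary: s t)
  case (Suc n)
  have "alt (Suc n) x y = alt n x y @ [if even n then x else y]" for x y :: 'a
    using alt_add[of n 1 x y] by simp
  then show ?case using Suc by auto
qed simp

locale coxeter =
  fixes S :: "'a set" and m :: "'a \<Rightarrow> 'a \<Rightarrow> enat"
  assumes coxeter: "coxeter_system S m"
begin

abbreviation equiv (infix "\<approx>" 50) where "w \<approx> v \<equiv> cox_eq S m w v"
abbreviation comm (infix "\<sim>" 50) where "w \<sim> v \<equiv> comm_eq S m w v"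

lemma finite_S: "finite S"
  using coxeter by (simp add: coxeter_system_def)

lemma m_sym: "s \<in> S \<Longrightarrow> t \<in> S \<Longrightarrow> s \<noteq> t \<Longrightarrow> m s t = m t s"
  using coxeter by (simp add: coxeter_system_def)

lemma m_ge_2: "s \<in> S \<Longrightarrow> t \<in> S \<Longrightarrow> s \<noteq> t \<Longrightarrow> 2 \<le> m s t"
  using coxeter by (simp add: coxeter_system_def)

lemma set_relator: "r \<in> relators S m \<Longrightarrow> set r \<subseteq> S"
  by (auto simp: relators_def split: if_splits)

section \<open>Congruence modulo the Coxeter relations\<close>

lemma equiv_trans [trans]: "u \<approx> v \<Longrightarrow> v \<approx> w \<Longrightarrow> u \<approx> w"
  by (induction rule: cox_eq.induct) (auto intro: cox_eq.intros)

lemma equiv_relator: "r \<in> relators S m \<Longrightarrow> u @ r @ v \<approx> u @ v"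
  by (auto intro: cox_eq.intros)

lemma equiv_sym: "u \<approx> v \<Longrightarrow> v \<approx> u"
proof (induction rule: cox_eq.induct)
  case (ins u v w r)
  have "u @ v \<approx> u @ r @ v" by (rule cox_eq.del[OF cox_eq.refl ins(2)])
  with ins show ?case by (blast intro: equiv_trans)
next
  case (del u r v w)
  then show ?case by (blast intro: equiv_trans equiv_relator)
qed (rule cox_eq.refl)

lemma equiv_context: "u \<approx> v \<Longrightarrow> p @ u @ q \<approx> p @ v @ q"
proof (induction rule: cox_eq.induct)
  case (ins u v w r)
  then show ?case using cox_eq.ins[of S m "p @ u" "v @ q" _ r] by simp
next
  case (del u r v w)
  then show ?case using cox_eq.del[of S m "p @ u" r "v @ q"] by simp
qed (rule cox_eq.refl)

lemma equiv_append: "u \<approx> v \<Longrightarrow> u' \<approx> v' \<Longrightarrow> u @ u' \<approx> v @ v'"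
  using equiv_context[of u v "[]" u'] equiv_context[of u' v' v "[]"] equiv_trans by simp

lemma equiv_Cons: "u \<approx> v \<Longrightarrow> s # u \<approx> s # v"
  using equiv_context[of u v "[s]" "[]"] by simp

lemma equiv_set: "u \<approx> v \<Longrightarrow> set u \<subseteq> S \<longleftrightarrow> set v \<subseteq> S"
  by (induction rule: cox_eq.induct) (use set_relator in auto)

lemma equiv_involution: "s \<in> S \<Longrightarrow> s # s # w \<approx> w"
  using equiv_relator[of "[s, s]" "[]" w] by (auto simp: relators_def)

lemma equiv_rev_cancel: "set u \<subseteq> S \<Longrightarrow> u @ rev u @ w \<approx> w"
proof (induction u arbitrary: w)
  case (Cons s u)
  have "s # (u @ rev u @ (s # w)) \<approx> s # s # w" using Cons by (intro equiv_Cons) auto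
  also have "\<dots> \<approx> w" using Cons by (intro equiv_involution) auto
  finally show ?case by simp
qed (simp add: cox_eq.refl)

lemma equiv_rev_cancel': "set u \<subseteq> S \<Longrightarrow> rev u @ u @ w \<approx> w"
  using equiv_rev_cancel[of "rev u" w] by simp

lemma equiv_Cons_iff: "s \<in> S \<Longrightarrow> s # u \<approx> s # v \<longleftrightarrow> u \<approx> v"
  by (meson equiv_Cons equiv_involution equiv_sym equiv_trans)

lemma equiv_Cons_shift: "s \<in> S \<Longrightarrow> s # u \<approx> v \<longleftrightarrow> u \<approx> s # v"
  by (meson equiv_Cons_iff equiv_involution equiv_sym equiv_trans)

lemma equiv_snoc_shift: "s \<in> S \<Longrightarrow> u @ [s] \<approx> v \<longleftrightarrow> u \<approx> v @ [s]"
proof -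
  assume s: "s \<in> S"
  have c: "x @ [s, s] \<approx> x" for x
    using equiv_append[OF cox_eq.refl equiv_involution[OF s, of "[]"], of x] by simp
  have "x @ [s] \<approx> y @ [s]" if "x \<approx> y" for x y
    using that by (intro equiv_append cox_eq.refl)
  from this[of "u @ [s]" v] this[of u "v @ [s]"] show ?thesis
    using c[of u] c[of v] by (auto intro: equiv_trans equiv_sym)
qed

lemma equiv_conj_shift: "s \<in> S \<Longrightarrow> u \<approx> s # r @ [s] \<longleftrightarrow> s # u @ [s] \<approx> r"
  using equiv_snoc_shift[of s "s # u" r] equiv_Cons_shift[of s u "r @ [s]"] by simp

text \<open>The multiplicity of \<open>r\<close> in the list of reflections \<open>s1\<close>,
  \<open>s1 s2 s1\<close>, \<open>s1 s2 s3 s2 s1\<close>, ... of the word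
  \<open>s1 s2 s3 ...\<close>. Conjugating \<open>r\<close> while letters are consumed avoids
  building that list.\<close>

primrec inversions :: "'a list \<Rightarrow> 'a list \<Rightarrow> nat" where
  "inversions [] r = 0"
| "inversions (s # w) r = (if [s] \<approx> r then 1 else 0) + inversions w (s # r @ [s])"

lemma inversions_cong: "r \<approx> r' \<Longrightarrow> inversions w r = inversions w r'"
proof (induction w arbitrary: r r')
  case (Cons s w)
  have "s # r @ [s] \<approx> s # r' @ [s]" using equiv_context[OF Cons.prems, of "[s]" "[s]"] by simp
  moreover have "[s] \<approx> r \<longleftrightarrow> [s] \<approx> r'" using Cons.prems by (meson equiv_sym equiv_trans)
  ultimately show ?case using Cons.IH by simp
qed simp

lemma inversions_append: "inversions (u @ v) r = inversions u r + inversions v (rev u @ r @ u)"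
  by (induction u arbitrary: r) auto

lemma inversions_alt:
  assumes "s \<in> S" "t \<in> S"
  shows "inversions (alt k s t) r = (\<Sum>j<k. if alt (2 * j + 1) s t \<approx> r then 1 else 0)"
  using assms
proof (induction k arbitrary: s t r)
  case (Suc k)
  have conj: "alt (2 * j + 1) t s \<approx> s # r @ [s] \<longleftrightarrow> alt (2 * Suc j + 1) s t \<approx> r" for j
    using Suc.prems alt_add[of "2 * j + 2" 1 s t] by (simp add: equiv_conj_shift)
  show ?case
    unfolding alt.simps inversions.simps Suc.IH[OF Suc.prems(2,1)] conj sum.lessThan_Suc_shift
    by simp
qed simp

lemma alt_relator:
  "s \<in> S \<Longrightarrow> t \<in> S \<Longrightarrow> s \<noteq> t \<Longrightarrow> m s t = enat n \<Longrightarrow> alt (2 * n) s t \<in> relators S m"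
  unfolding relators_def alt_even by blast

text \<open>A relator \<open>(s t)\<^sup>n\<close> runs twice through the same list of reflections.\<close>

lemma even_inversions_relator:
  assumes "R \<in> relators S m"
  shows "even (inversions R r)"
proof -
  consider s where "s \<in> S" "R = [s, s]"
    | s t n where "s \<in> S" "t \<in> S" "s \<noteq> t" "m s t = enat n" "R = alt (2 * n) s t"
    using assms unfolding relators_def alt_even by blast
  then show ?thesis
  proof cases
    case 1
    have "[s] \<approx> s # r @ [s] \<longleftrightarrow> [s] \<approx> r"
      using equiv_conj_shift[of s "[s]" r] equiv_involution[of s "[s]"] 1
      by (auto intro: equiv_trans equiv_sym)
    then show ?thesis using 1 by simp
  next
    case 2
    let ?f = "\<lambda>j. if alt (2 * j + 1) s t \<approx> r then 1 else 0 :: nat"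
    have "alt (2 * (n + j) + 1) s t = [] @ alt (2 * n) s t @ alt (2 * j + 1) s t" for j
      using alt_add[of "2 * n" "2 * j + 1" s t] by (simp add: algebra_simps)
    then have "alt (2 * (n + j) + 1) s t \<approx> alt (2 * j + 1) s t" for j
      using equiv_relator[OF alt_relator[OF 2(1-4)], of "[]"] by (metis append_Nil)
    then have "?f (n + j) = ?f j" for j by (meson equiv_sym equiv_trans)
    moreover have "(\<Sum>j<n + k. ?f j) = (\<Sum>j<n. ?f j) + (\<Sum>j<k. ?f (n + j))" for k
      by (induction k) simp_all
    from this[of n] have "(\<Sum>j<2 * n. ?f j) = (\<Sum>j<n. ?f j) + (\<Sum>j<n. ?f (n + j))"
      by (simp add: mult_2)
    ultimately have "inversions R r = 2 * (\<Sum>j<n. ?f j)"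
      unfolding 2(5) inversions_alt[OF 2(1,2)] by simp
    then show ?thesis by simp
  qed
qed

text \<open>As \<open>R\<close> is trivial in the group, \<open>v\<close> is still evaluated at an
  equivalent conjugate of \<open>r\<close>; only the even contribution of \<open>R\<close> itself is
  added.\<close>

lemma even_inversions_insert:
  assumes "R \<in> relators S m" "set u \<subseteq> S"
  shows "even (inversions (u @ R @ v) r) = even (inversions (u @ v) r)"
proof -
  have "R \<approx> []" using equiv_relator[OF assms(1), of "[]" "[]"] by simp
  moreover have "rev R \<approx> []"
    using equiv_rev_cancel'[OF set_relator[OF assms(1)], of "[]"] 
      equiv_append[OF cox_eq.refl \<open>R \<approx> []\<close>, of "rev R"] by (auto intro: equiv_sym equiv_trans)
  ultimately have "rev R @ q @ R \<approx> q" for q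
    using equiv_append[of "rev R" "[]" "q @ R" "q @ []"] equiv_append[OF cox_eq.refl, of R "[]" q] by simp
  from inversions_cong[OF this, of v "rev u @ r @ u"] show ?thesis
    using even_inversions_relator[OF assms(1)] by (simp add: inversions_append)
qed

lemma even_inversions_equiv:
  assumes "w \<approx> v" "set w \<subseteq> S"
  shows "even (inversions w r) = even (inversions v r)"
  using assms
  by (induction rule: cox_eq.induct) (use set_relator even_inversions_insert in auto)

text \<open>An inversion has the form \<open>u a u^-1\<close> for a prefix \<open>u @ [a]\<close> of
  \<open>w\<close>, so multiplying by it from the left cancels exactly this
  \<open>a\<close>.\<close>

lemma inversion_deletion:
  assumes "inversions w r > 0" "set w \<subseteq> S"
  shows "\<exists>u a v. w = u @ a # v \<and> r @ w \<approx> u @ v"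
  using assms
proof (induction w arbitrary: r)
  case (Cons s w)
  show ?case
  proof (cases "[s] \<approx> r")
    case True
    have "r @ s # w \<approx> [s] @ s # w" 
      using equiv_append[OF equiv_sym[OF True] cox_eq.refl, of "s # w"] .
    also have "\<dots> \<approx> [] @ w" using Cons equiv_involution by simp
    finally show ?thesis by (metis append_Nil)
  next
    case False
    then obtain u a v where w: "w = u @ a # v" "s # r @ s # w \<approx> u @ v"
      using Cons.IH[of "s # r @ [s]"] Cons.prems by auto
    then have "r @ s # w \<approx> (s # u) @ v" using Cons.prems equiv_Cons_shift by simp
    with w(1) show ?thesis by (metis append_Cons)
  qed
qed simp

definition minimal :: "'a list \<Rightarrow> bool" where
  "minimal w \<longleftrightarrow> set w \<subseteq> S \<and> (\<forall>v. w \<approx> v \<longrightarrow> length w \<le> length v)"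

lemma minimal_set: "minimal w \<Longrightarrow> set w \<subseteq> S"
  by (simp add: minimal_def)

lemma minimal_length_eq: "minimal w \<Longrightarrow> w \<approx> v \<Longrightarrow> length v = length w \<Longrightarrow> minimal v"
  unfolding minimal_def using equiv_set equiv_trans by metis

lemma exists_minimal: "set w \<subseteq> S \<Longrightarrow> \<exists>v. w \<approx> v \<and> minimal v"
proof (induction "length w" arbitrary: w rule: less_induct)
  case less
  show ?case
  proof (cases "minimal w")
    case True
    then show ?thesis using cox_eq.refl by blast
  next
    case False
    then obtain v where "w \<approx> v" "length v < length w"
      using less.prems by (auto simp: minimal_def not_le)
    then show ?thesis using less equiv_set equiv_trans by metis
  qed
qed

text \<open>Let \<open>v\<close> be a reduced word for \<open>s w\<close>; it is no longer than
  \<open>w\<close>. If \<open>s\<close> were an inversion of \<open>v\<close>, then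
  \<open>w\<close>, which equals \<open>s v\<close>, could be shortened. So \<open>s # v\<close>
  meets the reflection \<open>s\<close> exactly once, and parity carries over to
  \<open>w\<close>.\<close>

lemma exchange:
  assumes w: "minimal w" and s: "s \<in> S" and nred: "\<not> minimal (s # w)"
  shows "inversions w [s] > 0"
proof -
  have sS: "set (s # w) \<subseteq> S" using w s by (simp add: minimal_def)
  then obtain v where v: "s # w \<approx> v" "minimal v" using exists_minimal by blast
  have sv: "w \<approx> s # v" using v(1) s equiv_Cons_shift by simp
  obtain v' where "s # w \<approx> v'" "length v' < length (s # w)"
    using nred sS by (auto simp: minimal_def not_le)
  then have len: "length v \<le> length w"
    using v unfolding minimal_def by (metis equiv_sym equiv_trans le_trans length_Cons less_Suc_eq_le)
  have "inversions v [s] = 0"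
  proof (rule ccontr)
    assume "inversions v [s] \<noteq> 0"
    then obtain x a y where "v = x @ a # y" "[s] @ v \<approx> x @ y"
      using inversion_deletion[of v "[s]"] v(2) by (auto simp: minimal_def)
    then have "w \<approx> x @ y" "length (x @ y) < length w"
      using sv equiv_trans len by auto
    then show False using w by (auto simp: minimal_def not_le[symmetric])
  qed
  moreover have "inversions v [s, s, s] = inversions v [s]"
    using s by (intro inversions_cong) (simp add: equiv_involution)
  ultimately have "inversions (s # v) [s] = 1" by (simp add: cox_eq.refl)
  then have "odd (inversions w [s])"
    using even_inversions_equiv[OF sv, of "[s]"] minimal_set[OF w] by simp
  then show ?thesis by (auto elim: oddE)
qed

section \<open>Commutation classes\<close>

definition indep :: "'a \<Rightarrow> 'a \<Rightarrow> bool" where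
  "indep s t \<longleftrightarrow> s \<in> S \<and> t \<in> S \<and> s \<noteq> t \<and> m s t = 2"

lemma indep_sym: "indep s t \<Longrightarrow> indep t s"
  using m_sym by (auto simp: indep_def)

lemma comm_trans [trans]: "u \<sim> v \<Longrightarrow> v \<sim> w \<Longrightarrow> u \<sim> w"
  by (induction rule: comm_eq.induct) (blast intro: comm_eq.intros)+

lemma comm_swap: "indep s t \<Longrightarrow> u @ [s, t] @ v \<sim> u @ [t, s] @ v"
  using indep_sym[of s t] by (intro comm_eq.swap[OF comm_eq.refl]) (auto simp: indep_def)

lemma comm_induct [consumes 1, case_names refl swap]:
  assumes "u \<sim> w" "P w"
    and "\<And>p s t q. p @ [s, t] @ q \<sim> w \<Longrightarrow> indep s t \<Longrightarrow> P (p @ [s, t] @ q) \<Longrightarrow> P (p @ [t, s] @ q)"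
  shows "P u"
  using assms by (induction rule: comm_eq.induct) (auto simp: indep_def)

lemma comm_sym: "u \<sim> v \<Longrightarrow> v \<sim> u"
  by (induction rule: comm_induct) (blast intro: comm_eq.refl comm_swap comm_trans)+

lemma comm_context: "u \<sim> v \<Longrightarrow> p @ u @ q \<sim> p @ v @ q"
proof (induction rule: comm_induct)
  case (swap p' s t q')
  then have "(p @ p') @ [t, s] @ (q' @ q) \<sim> (p @ p') @ [s, t] @ (q' @ q)"
    using comm_swap indep_sym by blast
  also have "\<dots> \<sim> p @ v @ q" using swap by simp
  finally show ?case by simp
qed (rule comm_eq.refl)

lemma comm_append: "u \<sim> v \<Longrightarrow> u' \<sim> v' \<Longrightarrow> u @ u' \<sim> v @ v'"
  using comm_context[of u v "[]" u'] comm_context[of u' v' v "[]"] comm_trans by simp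

lemma comm_Cons: "u \<sim> v \<Longrightarrow> s # u \<sim> s # v"
  using comm_context[of u v "[s]" "[]"] by simp

lemma comm_length: "u \<sim> v \<Longrightarrow> length u = length v"
  by (induction rule: comm_induct) auto

lemma comm_set: "u \<sim> v \<Longrightarrow> set u = set v"
  by (induction rule: comm_induct) auto

lemma comm_move: "\<forall>y\<in>set p. indep a y \<Longrightarrow> a # p @ q \<sim> p @ a # q"
proof (induction p)
  case (Cons b p)
  have "a # b # p @ q \<sim> b # a # p @ q"
    using comm_swap[of a b "[]" "p @ q"] Cons.prems by simp
  also have "\<dots> \<sim> b # p @ a # q" using Cons by (intro comm_Cons) auto
  finally show ?case by simp
qed (simp add: comm_eq.refl)

text \<open>The occurrence of \<open>a\<close> that reaches the front can only pass letters that
  commute with it. The induction tracks it through each swap: the swapped pair lies behind it,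
  contains it, or lies before it.\<close>

lemma comm_initial:
  assumes "v \<sim> a # w"
  shows "\<exists>x y. v = x @ a # y \<and> (\<forall>z\<in>set x. indep a z) \<and> w \<sim> x @ y"
  using assms
proof (induction rule: comm_induct)
  case refl
  show ?case by (intro exI[of _ "[]"] exI[of _ w]) (simp add: comm_eq.refl)
next
  case (swap p s t q)
  then obtain x y where xy: "p @ [s, t] @ q = x @ a # y" "\<forall>z\<in>set x. indep a z" "w \<sim> x @ y"
    by blast
  consider z where "p = x @ a # z" "y = z @ [s, t] @ q"
    | "p = x" "a = s" "y = t # q"
    | "x = p @ [s]" "a = t" "y = q"
    | z where "x = p @ [s, t] @ z" "q = z @ a # y"
    using xy(1) by (auto simp: append_eq_append_conv2 Cons_eq_append_conv append_eq_Cons_conv)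
  then show ?case
  proof cases
    case 1
    have "w \<sim> (x @ z) @ [s, t] @ q" using xy(3) 1 by simp
    also have "\<dots> \<sim> (x @ z) @ [t, s] @ q" using swap(2) by (rule comm_swap)
    finally have "w \<sim> (x @ z) @ [t, s] @ q" .
    then show ?thesis using 1 xy(2) by (intro exI[of _ x] exI[of _ "z @ [t, s] @ q"]) simp
  next
    case 2
    then show ?thesis using xy swap(2) by (intro exI[of _ "p @ [t]"] exI[of _ q]) auto
  next
    case 3
    then show ?thesis using xy by (intro exI[of _ p] exI[of _ "s # q"]) auto
  next
    case 4
    have "w \<sim> p @ [s, t] @ z @ y" using xy(3) 4 by simp
    also have "\<dots> \<sim> p @ [t, s] @ z @ y" using swap(2) by (rule comm_swap)
    finally have "w \<sim> p @ [t, s] @ z @ y" .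
    then show ?thesis using 4 xy(2) by (intro exI[of _ "p @ [t, s] @ z"] exI[of _ y]) auto
  qed
qed

section \<open>Lexicographic normal forms\<close>

definition rank :: "'a \<Rightarrow> nat" where
  "rank = to_nat_on S"

lemma rank_inj: "s \<in> S \<Longrightarrow> t \<in> S \<Longrightarrow> rank s = rank t \<Longrightarrow> s = t"
  using inj_on_to_nat_on[OF countable_finite[OF finite_S]] by (auto simp: rank_def inj_on_def)

text \<open>The letter \<open>a\<close>, written after \<open>w\<close>, could jump in front of a
  larger letter. Forbidding this for every prefix is the Anisimov-Knuth description of the
  lexicographically least word of a class.\<close>

definition descent :: "'a list \<Rightarrow> 'a \<Rightarrow> bool" where
  "descent w a \<longleftrightarrow> (\<exists>p b x. w = p @ b # x \<and> rank a < rank b \<and> (\<forall>y\<in>set (b # x). indep a y))"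

definition normal :: "'a list \<Rightarrow> bool" where
  "normal w \<longleftrightarrow> (\<forall>p a q. w = p @ a # q \<longrightarrow> \<not> descent p a)"

lemma append_eq_append_Cons:
  "u @ v = p @ a # q \<longleftrightarrow> (\<exists>z. u = p @ a # z \<and> q = z @ v) \<or> (\<exists>z. p = u @ z \<and> v = z @ a # q)"
  by (auto simp: append_eq_append_conv2 append_eq_Cons_conv)

lemma descent_append:
  "descent (u @ v) a \<longleftrightarrow> descent v a \<or> descent u a \<and> (\<forall>y\<in>set v. indep a y)"
proof
  assume "descent (u @ v) a"
  then obtain p b x where uv: "u @ v = p @ b # x" and b: "rank a < rank b" "\<forall>y\<in>set (b # x). indep a y"
    by (auto simp: descent_def)
  from uv consider z where "v = z @ b # x" | z where "u = p @ b # z" "x = z @ v"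
    by (auto simp: append_eq_append_Cons)
  then show "descent v a \<or> descent u a \<and> (\<forall>y\<in>set v. indep a y)"
  proof cases
    case 1
    then have "descent v a" using b by (auto simp: descent_def)
    then show ?thesis by blast
  next
    case 2
    then have "descent u a" using b by (auto simp: descent_def)
    then show ?thesis using 2 b by auto
  qed
next
  assume "descent v a \<or> descent u a \<and> (\<forall>y\<in>set v. indep a y)"
  then show "descent (u @ v) a"
    unfolding descent_def
  proof (elim disjE conjE exE)
    fix p b x assume "v = p @ b # x" "rank a < rank b" "\<forall>y\<in>set (b # x). indep a y"
    then show "\<exists>p b x. u @ v = p @ b # x \<and> rank a < rank b \<and> (\<forall>y\<in>set (b # x). indep a y)"
      by (intro exI[of _ "u @ p"] exI[of _ b] exI[of _ x]) auto
  next
    fix p b x assume "\<forall>y\<in>set v. indep a y" "u = p @ b # x" "rank a < rank b" "\<forall>y\<in>set (b # x). indep a y"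
    then show "\<exists>p b x. u @ v = p @ b # x \<and> rank a < rank b \<and> (\<forall>y\<in>set (b # x). indep a y)"
      by (intro exI[of _ p] exI[of _ b] exI[of _ "x @ v"]) auto
  qed
qed

lemma normal_append:
  "normal (u @ v) \<longleftrightarrow> normal u \<and> (\<forall>p a q. v = p @ a # q \<longrightarrow> \<not> descent (u @ p) a)"
  unfolding normal_def append_eq_append_Cons by blast

lemma normal_tl:
  assumes "normal (s # w)"
  shows "normal w"
  unfolding normal_def
proof (intro allI impI)
  fix p a q assume "w = p @ a # q"
  then have "\<not> descent (s # p) a" using assms by (auto simp: normal_def)
  then show "\<not> descent p a" using descent_append[of "[s]" p a] by simp
qed

lemma descent_Cons: "rank a < rank b \<Longrightarrow> \<forall>y\<in>set (b # x). indep a y \<Longrightarrow> descent (b # x) a"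
  unfolding descent_def by (intro exI[of _ "[]"]) auto

text \<open>The memory needed after \<open>u\<close> is whether \<open>u\<close> is normal and which
  letters are descents of \<open>u\<close>: by \<open>descent_append\<close>, such a letter stays
  critical as long as only letters commuting with it follow.\<close>

lemma regular_normal: "regular S {w. normal w}"
proof (rule regularI)
  let ?f = "\<lambda>(n, D). {v. n \<and> (\<forall>p a q. v = p @ a # q \<longrightarrow> \<not> descent p a \<and> \<not> (a \<in> D \<and> (\<forall>y\<in>set p. indep a y)))}"
  show "finite (UNIV \<times> Pow S :: (bool \<times> 'a set) set)" using finite_S by simp
  show "\<exists>x\<in>UNIV \<times> Pow S. residual {w. normal w} u = ?f x" for u
  proof (rule bexI[of _ "(normal u, {a \<in> S. descent u a})"])
    have "a \<in> S" if "descent u a" for a using that by (auto simp: descent_def indep_def)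
    then show "residual {w. normal w} u = ?f (normal u, {a \<in> S. descent u a})"
      by (auto simp: residual_def normal_append descent_append)
  qed auto
qed

text \<open>Bring the least possible letter \<open>a\<close> to the front and normalise the rest. A
  remaining descent would have to overtake \<open>a\<close> itself, so that a smaller letter could
  have come first.\<close>

lemma exists_normal: "\<exists>n. w \<sim> n \<and> normal n"
proof (induction "length w" arbitrary: w)
  case 0
  then show ?case by (intro exI[of _ "[]"]) (auto simp: comm_eq.refl normal_def)
next
  case (Suc k)
  let ?P = "\<lambda>a. \<exists>w'. w \<sim> a # w'"
  obtain b w'' where "w = b # w''" using Suc by (cases w) auto
  then have "?P b" using comm_eq.refl by blast
  then obtain a where a: "?P a" and least: "\<And>c. ?P c \<Longrightarrow> rank a \<le> rank c"
    using ex_has_least_nat[of ?P b rank] by blast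
  then obtain w' where w': "w \<sim> a # w'" by blast
  then have "k = length w'" using comm_length Suc(2) by fastforce
  then obtain n where n: "w' \<sim> n" "normal n" using Suc(1) by blast
  have wn: "w \<sim> a # n" using w' comm_Cons[OF n(1)] comm_trans by blast
  have "\<not> descent p c" if "a # n = p @ c # q" for p c q
  proof
    assume "descent p c"
    with that obtain x where x: "p = a # x" "n = x @ c # q" by (cases p) (auto simp: descent_def)
    then have "\<not> descent x c" using n(2) by (auto simp: normal_def)
    then have "descent [a] c" and indep: "\<forall>y\<in>set x. indep c y"
      using \<open>descent p c\<close> descent_append[of "[a]" x c] x by auto
    then have less: "rank c < rank a" and "indep c a"
      by (auto simp: descent_def Cons_eq_append_conv)
    then have "c # (a # x) @ q \<sim> (a # x) @ c # q" using indep by (intro comm_move) auto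
    then have "w \<sim> c # (a # x) @ q" using comm_trans[OF wn] comm_sym x by simp
    with least less show False by fastforce
  qed
  then have "normal (a # n)" by (auto simp: normal_def)
  with wn show ?case by blast
qed

text \<open>If the first letters differ, each can be moved to the front of the other word, and the
  smaller one would be a descent there. Otherwise cancel the first letter.\<close>

lemma normal_unique: "w \<sim> v \<Longrightarrow> normal w \<Longrightarrow> normal v \<Longrightarrow> w = v"
proof (induction w arbitrary: v)
  case Nil
  then show ?case using comm_length[of "[]" v] by simp
next
  case (Cons a w)
  have no_overtaking: "\<not> rank b < rank c"
    if v: "v' \<sim> b # w'" and n: "normal v'" and c: "v' = c # u" and "b \<noteq> c" for v' b c u w'
  proof
    assume less: "rank b < rank c"
    obtain x y where xy: "v' = x @ b # y" "\<forall>z\<in>set x. indep b z" using comm_initial[OF v] by blast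
    with c \<open>b \<noteq> c\<close> obtain x' where x: "x = c # x'" by (cases x) auto
    then show False using n xy less descent_Cons[of b c x'] by (auto simp: normal_def)
  qed
  obtain x y where xy: "v = x @ a # y" "\<forall>z\<in>set x. indep a z" "w \<sim> x @ y"
    using comm_initial[OF comm_sym[OF Cons.prems(1)]] by blast
  have "x = []"
  proof (rule ccontr)
    assume "x \<noteq> []"
    then obtain b x' where x: "x = b # x'" by (cases x) auto
    then have "a \<noteq> b" "rank a \<noteq> rank b" using xy(2) rank_inj by (auto simp: indep_def)
    moreover have "\<not> rank a < rank b"
      using no_overtaking[OF comm_sym[OF Cons.prems(1)] Cons.prems(3)] \<open>a \<noteq> b\<close> xy(1) x by simp
    moreover have "\<not> rank b < rank a"
      using no_overtaking[of "a # w" b "x' @ a # y" a w] Cons.prems(1,2) \<open>a \<noteq> b\<close> xy(1) x by simp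
    ultimately show False by simp
  qed
  then show ?case using Cons xy normal_tl by auto
qed

section \<open>Products of commutation-closed languages\<close>

definition comm_closed :: "'a list set \<Rightarrow> bool" where
  "comm_closed A \<longleftrightarrow> (\<forall>u\<in>A. \<forall>v. u \<sim> v \<longrightarrow> v \<in> A)"

lemma comm_closedD: "comm_closed A \<Longrightarrow> u \<sim> v \<Longrightarrow> u \<in> A \<longleftrightarrow> v \<in> A"
  using comm_sym by (auto simp: comm_closed_def)

lemma comm_closed_lists: "comm_closed (lists S)"
  using comm_set by (auto simp: comm_closed_def lists_eq_set)

lemma comm_closed_class: "comm_closed {w. w \<sim> b}"
  unfolding comm_closed_def using comm_sym comm_trans by blast

lemma comm_closed_residual: "comm_closed K \<Longrightarrow> comm_closed (residual K u)"
  unfolding comm_closed_def residual_def using comm_append[OF comm_eq.refl] by blast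

lemma residual_comm: "comm_closed K \<Longrightarrow> v \<sim> v' \<Longrightarrow> residual K v = residual K v'"
  unfolding residual_def using comm_append[OF _ comm_eq.refl] comm_closedD by blast

definition trace_prod :: "'a list set \<Rightarrow> 'a list set \<Rightarrow> 'a list set" where
  "trace_prod A B = {w. \<exists>a\<in>A. \<exists>b\<in>B. w \<sim> a @ b}"

lemma comm_closed_trace_prod: "comm_closed (trace_prod A B)"
  unfolding comm_closed_def trace_prod_def using comm_sym comm_trans by blast

lemma comm_closed_UN: "(\<And>i. i \<in> I \<Longrightarrow> comm_closed (A i)) \<Longrightarrow> comm_closed (\<Union>i\<in>I. A i)"
  unfolding comm_closed_def by blast

text \<open>The colour \<open>False\<close> marks letters of the first factor and
  \<open>True\<close> those of the second.\<close>

definition part :: "bool \<Rightarrow> ('a \<times> bool) list \<Rightarrow> 'a list" where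
  "part b c = map fst (filter (\<lambda>x. snd x = b) c)"

lemma part_simps [simp]:
  "part b [] = []"
  "part b (x # c) = (if snd x = b then fst x # part b c else part b c)"
  "part b (c @ d) = part b c @ part b d"
  by (auto simp: part_def)

lemma part_set: "set (part b c) = {s. (s, b) \<in> set c}"
  by (force simp: part_def)

abbreviation split_ok :: "('a \<times> bool) list \<Rightarrow> bool" where
  "split_ok \<equiv> sorted_wrt (\<lambda>x y. snd x \<longrightarrow> \<not> snd y \<longrightarrow> indep (fst x) (fst y))"

lemma comm_split:
  assumes "split_ok c"
  shows "map fst c \<sim> part False c @ part True c"
  using assms
proof (induction c)
  case (Cons x c)
  then have IH: "fst x # map fst c \<sim> fst x # part False c @ part True c" by (intro comm_Cons) auto
  show ?case
  proof (cases "snd x")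
    case True
    then have "\<forall>y\<in>set (part False c). indep (fst x) y" using Cons.prems by (auto simp: part_set)
    from comm_trans[OF IH comm_move[OF this]] show ?thesis using True by simp
  qed (use IH in simp)
qed (simp add: comm_eq.refl)

text \<open>A word lies in the product iff its letters can be coloured with two colours such that the two
  colour classes spell words of the two factors and no letter of the second colour has to
  stay before a letter of the first. This criterion can be checked from left to right.\<close>

lemma trace_prod_split:
  assumes "comm_closed A" "comm_closed B"
  shows "w \<in> trace_prod A B \<longleftrightarrow> (\<exists>c. map fst c = w \<and> split_ok c \<and> part False c \<in> A \<and> part True c \<in> B)"
    (is "_ \<longleftrightarrow> ?split w")
proof
  assume "?split w"
  then show "w \<in> trace_prod A B" using comm_split by (auto simp: trace_prod_def)
next
  assume "w \<in> trace_prod A B"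
  then obtain a b where ab: "a \<in> A" "b \<in> B" "w \<sim> a @ b" by (auto simp: trace_prod_def)
  from ab(3) show "?split w"
  proof (induction rule: comm_induct)
    case refl
    let ?c = "map (\<lambda>x. (x, False)) a @ map (\<lambda>x. (x, True)) b"
    have "map fst ?c = a @ b" "part False ?c = a" "part True ?c = b"
      by (simp_all add: part_def comp_def filter_map)
    moreover have "split_ok ?c" by (auto simp: sorted_wrt_append sorted_wrt_map)
    ultimately show ?case using ab(1,2) by (intro exI[of _ ?c]) simp
  next
    case (swap p s t q)
    then obtain c where c: "map fst c = p @ [s, t] @ q" "split_ok c" "part False c \<in> A" "part True c \<in> B"
      by blast
    then obtain c1 i j c2 where c12: "c = c1 @ [(s, i), (t, j)] @ c2" "p = map fst c1" "q = map fst c2"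
      by (auto simp: map_eq_append_conv map_eq_Cons_conv)
    let ?d = "c1 @ [(t, j), (s, i)] @ c2"
    \<comment> \<open>Colours travel with the letters. The swap is a commutation within one colour
      class if \<open>i = j\<close>, and is invisible in both classes otherwise.\<close>
    have parts: "part b c \<sim> part b ?d" for b
      using comm_swap[OF swap(2), of "part b c1" "part b c2"] by (simp add: c12 comm_eq.refl)
    have "part False ?d \<in> A" "part True ?d \<in> B"
      using comm_closedD[OF assms(1) parts[of False]] comm_closedD[OF assms(2) parts[of True]] c(3,4)
      by blast+
    moreover have "split_ok ?d"
      using c(2) swap(2) indep_sym[OF swap(2)] unfolding c12 by (auto simp: sorted_wrt_append)
    ultimately show ?case using c12 by (intro exI[of _ ?d]) simp
  qed
qed

text \<open>A subset construction over all colourings of the prefix. One colouring is remembered by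
  the residuals of \<open>A\<close> and \<open>B\<close> after its two parts and by the set of
  \<open>True\<close> letters seen, which all later \<open>False\<close> letters must commute
  with.\<close>

lemma regular_trace_prod:
  assumes "comm_closed A" "comm_closed B" "regular S A" "regular S B"
  shows "regular S (trace_prod A B)"
proof (rule regularI)
  let ?g = "\<lambda>(X, Y, D). {v. \<exists>c. map fst c = v \<and> split_ok c \<and> part False c \<in> X \<and> part True c \<in> Y \<and>
      (\<forall>x\<in>D. \<forall>y\<in>set (part False c). indep x y)}"
  let ?T = "residual A ` lists S \<times> residual B ` lists S \<times> Pow S"
  show "finite (Pow ?T)" using assms(3,4) finite_S by (simp add: regular_def)
  fix u assume u: "set u \<subseteq> S"
  define h where "h c = (residual A (part False c), residual B (part True c), set (part True c))" for c
  show "\<exists>X\<in>Pow ?T. residual (trace_prod A B) u = \<Union> (?g ` X)"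
  proof
    have "part b c \<in> lists S" if "map fst c = u" for b c
      using that u by (force simp: part_set lists_eq_set)
    then show "h ` {c. map fst c = u \<and> split_ok c} \<in> Pow ?T"
      by (auto simp: h_def lists_eq_set)
    show "residual (trace_prod A B) u = \<Union> (?g ` h ` {c. map fst c = u \<and> split_ok c})"
    proof (intro set_eqI iffI)
      fix v assume "v \<in> residual (trace_prod A B) u"
      then obtain c where c: "map fst c = u @ v" "split_ok c" "part False c \<in> A" "part True c \<in> B"
        using trace_prod_split[OF assms(1,2)] by (auto simp: residual_def)
      then obtain c1 c2 where c12: "c = c1 @ c2" "u = map fst c1" "v = map fst c2"
        by (auto simp: map_eq_append_conv)
      have "v \<in> ?g (h c1)"
        using c unfolding c12 h_def
        by (force simp: residual_def sorted_wrt_append part_set intro!: exI[of _ c2])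
      moreover have "c1 \<in> {c. map fst c = u \<and> split_ok c}"
        using c(2) c12 by (simp add: sorted_wrt_append)
      ultimately show "v \<in> \<Union> (?g ` h ` {c. map fst c = u \<and> split_ok c})"
        by (intro UnionI[of "?g (h c1)"] imageI)
    next
      fix v assume "v \<in> \<Union> (?g ` h ` {c. map fst c = u \<and> split_ok c})"
      then obtain c1 c2 where c1: "map fst c1 = u" "split_ok c1" and c2: "map fst c2 = v" "split_ok c2"
        "part False c1 @ part False c2 \<in> A" "part True c1 @ part True c2 \<in> B"
        "\<forall>x\<in>set (part True c1). \<forall>y\<in>set (part False c2). indep x y"
        by (auto simp: h_def residual_def)
      have "split_ok (c1 @ c2)" using c1 c2 by (force simp: sorted_wrt_append part_set)
      then show "v \<in> residual (trace_prod A B) u"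
        using c1 c2 trace_prod_split[OF assms(1,2), of "u @ v"]
        by (auto simp: residual_def intro!: exI[of _ "c1 @ c2"])
    qed
  qed
qed

section \<open>Rotations and avoidance of forbidden factors\<close>

definition rotations :: "'a list set \<Rightarrow> 'a list set" where
  "rotations K = {w. \<exists>u v. w \<sim> u @ v \<and> v @ u \<in> K}"

text \<open>With \<open>R\<close> the residual of \<open>K\<close> after \<open>v\<close>, the
  condition \<open>v @ u \<in> K\<close> reads \<open>u \<in> R\<close>. So the rotations are a
  finite union of products over the possible \<open>R\<close>; closedness of \<open>K\<close> makes
  this residual depend only on the class of \<open>v\<close>.\<close>

lemma regular_rotations:
  assumes "K \<subseteq> lists S" "comm_closed K" "regular S K"
  shows "regular S (rotations K)"
proof -
  have "rotations K = (\<Union>R\<in>residual K ` lists S. trace_prod R {v. residual K v = R})"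
    using assms(1) by (fastforce simp: rotations_def trace_prod_def residual_def)
  moreover have "regular S (trace_prod R {v. residual K v = R})" if "R \<in> residual K ` lists S" for R
  proof (rule regular_trace_prod)
    show "comm_closed R" using that assms(2) comm_closed_residual by auto
    show "comm_closed {v. residual K v = R}"
      using residual_comm[OF assms(2)] by (auto simp: comm_closed_def)
    show "regular S R" using that assms(3) regular_residual by (auto simp: lists_eq_set)
    show "regular S {v. residual K v = R}" using assms(3) by (rule regular_residual_eq)
  qed
  ultimately show ?thesis
    using assms(3) by (simp only: regular_UN regular_def[of S K])
qed

definition forbidden :: "'a list set" where
  "forbidden = {[s, s] | s. s \<in> S} \<union>
    {alt n s t | s t n. s \<in> S \<and> t \<in> S \<and> s \<noteq> t \<and> m s t = enat n \<and> n \<noteq> 2}"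

lemma forbidden_subset: "forbidden \<subseteq> lists S"
  using set_alt by (fastforce simp: forbidden_def lists_eq_set)

lemma finite_forbidden: "finite forbidden"
proof (rule finite_subset)
  \<comment> \<open>For \<open>m s t = \<infinity>\<close> the value of \<open>the_enat\<close> is
    unspecified; this is harmless in a finite superset.\<close>
  show "forbidden \<subseteq> (\<lambda>s. [s, s]) ` S \<union> (\<lambda>(s, t). alt (the_enat (m s t)) s t) ` (S \<times> S)"
    by (force simp: forbidden_def)
qed (use finite_S in simp)

definition fc_word :: "'a list \<Rightarrow> bool" where
  "fc_word w \<longleftrightarrow> set w \<subseteq> S \<and> (\<forall>x b y. w \<sim> x @ b @ y \<longrightarrow> b \<notin> forbidden)"

definition cfc_word :: "'a list \<Rightarrow> bool" where
  "cfc_word w \<longleftrightarrow> set w \<subseteq> S \<and> (\<forall>u v. w \<sim> u @ v \<longrightarrow> fc_word (v @ u))"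

text \<open>The words that fail \<open>fc_word\<close> form the products of all words, the finite
  class of a forbidden factor, and all words again. A word over \<open>S\<close> fails
  \<open>cfc_word\<close> iff it lies in the rotations of that language.\<close>

lemma regular_cfc_word: "regular S {w. cfc_word w}"
proof -
  define K where "K = (\<Union>b\<in>forbidden. trace_prod (lists S) (trace_prod {w. w \<sim> b} (lists S)))"
  have K: "K = lists S - {w. fc_word w}"
  proof (intro set_eqI iffI)
    fix w assume "w \<in> K"
    then obtain x b c y v where b: "b \<in> forbidden" "x \<in> lists S" "y \<in> lists S"
      "c \<sim> b" "v \<sim> c @ y" "w \<sim> x @ v"
      unfolding K_def trace_prod_def by blast
    have "w \<sim> x @ v" by fact
    also have "\<dots> \<sim> x @ c @ y" using b by (intro comm_append comm_eq.refl)
    also have "\<dots> \<sim> x @ b @ y" using b by (intro comm_append comm_eq.refl)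
    finally have *: "w \<sim> x @ b @ y" .
    moreover have "set w \<subseteq> S"
      unfolding comm_set[OF *] using b forbidden_subset by (auto simp: lists_eq_set)
    ultimately show "w \<in> lists S - {w. fc_word w}"
      using b(1) by (auto simp: fc_word_def lists_eq_set)
  next
    fix w assume "w \<in> lists S - {w. fc_word w}"
    then obtain x b y where w: "set w \<subseteq> S" "w \<sim> x @ b @ y" "b \<in> forbidden"
      by (auto simp: fc_word_def lists_eq_set)
    have "x \<in> lists S" "y \<in> lists S" using w(1) comm_set[OF w(2)] by (auto simp: lists_eq_set)
    then show "w \<in> K" unfolding K_def trace_prod_def using w(2,3) comm_eq.refl by blast
  qed
  have fin: "finite {w. w \<sim> b}" if "b \<in> forbidden" for b
  proof (rule finite_subset)
    show "{w. w \<sim> b} \<subseteq> {w. set w \<subseteq> S \<and> length w = length b}"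
      using that forbidden_subset comm_set comm_length unfolding lists_eq_set by blast
  qed (simp add: finite_lists_length_eq finite_S)
  have "regular S K"
    unfolding K_def using fin
    by (intro regular_UN finite_forbidden regular_trace_prod comm_closed_lists comm_closed_trace_prod
        comm_closed_class regular_lists regular_finite) auto
  moreover have "comm_closed K"
    unfolding K_def by (intro comm_closed_UN comm_closed_trace_prod)
  ultimately have "regular S (lists S \<inter> - rotations K)"
    by (intro regular_Int regular_lists regular_Compl regular_rotations) (use K in auto)
  moreover have "lists S \<inter> - rotations K = {w. cfc_word w}"
    using comm_set by (fastforce simp: K rotations_def cfc_word_def lists_eq_set)
  ultimately show ?thesis by simp
qed

section \<open>Stembridge's criterion\<close>

text \<open>This is \<open>-2 B(s, t)\<close> for the canonical bilinear form \<open>B\<close> on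
  simple roots; the value 2 is the limit for infinite order.\<close>

definition bond_weight :: "'a \<Rightarrow> 'a \<Rightarrow> real" where
  "bond_weight s t = (case m s t of enat n \<Rightarrow> 2 * cos (pi / n) | \<infinity> \<Rightarrow> 2)"

text \<open>The geometric representation in the basis of simple roots; words act from the right.\<close>

definition reflect :: "'a \<Rightarrow> ('a \<Rightarrow> real) \<Rightarrow> 'a \<Rightarrow> real" where
  "reflect s v = v(s := - v s + (\<Sum>u\<in>S - {s}. bond_weight s u * v u))"

primrec act :: "'a list \<Rightarrow> ('a \<Rightarrow> real) \<Rightarrow> 'a \<Rightarrow> real" where
  "act [] v = v"
| "act (s # w) v = act w (reflect s v)"

lemma act_append: "act (u @ w) v = act w (act u v)"
  by (induction u arbitrary: v) auto

lemma bond_weight_sym: "s \<in> S \<Longrightarrow> t \<in> S \<Longrightarrow> s \<noteq> t \<Longrightarrow> bond_weight s t = bond_weight t s"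
  using m_sym by (simp add: bond_weight_def)

lemma reflect_involution: "reflect s (reflect s v) = v"
  by (auto simp: reflect_def fun_eq_iff intro!: sum.cong)

text \<open>Only the coordinates \<open>s\<close> and \<open>t\<close> change, by affine maps with
  common fixed point \<open>(P, Q)\<close>. The deviations from it, listed in the order in which the
  coordinates are updated, satisfy a Chebyshev recurrence.\<close>

lemma act_dihedral:
  fixes h :: "nat \<Rightarrow> real"
  assumes st: "s \<in> S" "t \<in> S" "s \<noteq> t"
    and h: "\<And>k. h (k + 2) = bond_weight s t * h (k + 1) - h k"
    and P: "2 * P = bond_weight s t * Q + (\<Sum>u\<in>S - {s, t}. bond_weight s u * v u)"
    and Q: "2 * Q = bond_weight s t * P + (\<Sum>u\<in>S - {s, t}. bond_weight t u * v u)"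
    and v: "v s = h 0 + P" "v t = h 1 + Q"
  shows "act (alt (2 * n) s t) v = v(s := h (2 * n) + P, t := h (2 * n + 1) + Q)"
proof (induction n)
  case 0
  show ?case using v by auto
next
  case (Suc n)
  let ?c = "bond_weight s t"
  have S: "S - {s} = insert t (S - {s, t})" "S - {t} = insert s (S - {s, t})" using st by auto
  have sums: "(\<Sum>u\<in>S - {s, t}. bond_weight s u * (v(s := a, t := b)) u) = 2 * P - ?c * Q"
    "(\<Sum>u\<in>S - {s, t}. bond_weight t u * (v(s := a, t := b)) u) = 2 * Q - ?c * P" for a b
    unfolding P Q by (auto intro!: sum.cong)
  have reflect_s: "reflect s (v(s := a, t := b)) = v(s := ?c * b - a + (2 * P - ?c * Q), t := b)" for a b
    unfolding reflect_def S(1) using finite_S st(3) sums(1)[of a b] by (simp add: fun_eq_iff)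
  have reflect_t: "reflect t (v(s := a, t := b)) = v(s := a, t := ?c * a - b + (2 * Q - ?c * P))" for a b
    unfolding reflect_def S(2) using finite_S st sums(2)[of a b] by (simp add: fun_eq_iff bond_weight_sym[of t s])
  have h': "h (2 * n + 2) = ?c * h (2 * n + 1) - h (2 * n)"
    "h (2 * n + 3) = ?c * h (2 * n + 2) - h (2 * n + 1)"
    using h[of "2 * n"] h[of "2 * n + 1"] by (simp_all add: numeral_3_eq_3)
  have "alt (2 * Suc n) s t = alt (2 * n) s t @ [s, t]"
    using alt_add[of "2 * n" 2 s t] alt_even[of 1 s t] by simp
  then have "act (alt (2 * Suc n) s t) v
      = reflect t (reflect s (v(s := h (2 * n) + P, t := h (2 * n + 1) + Q)))"
    by (simp only: act_append Suc act.simps)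
  also have "\<dots> = v(s := h (2 * n + 2) + P, t := h (2 * n + 3) + Q)"
    unfolding reflect_s reflect_t h' by (simp add: fun_eq_iff algebra_simps)
  finally have "act (alt (2 * Suc n) s t) v = v(s := h (2 * n + 2) + P, t := h (2 * n + 3) + Q)" .
  moreover have "2 * Suc n = 2 * n + 2" "2 * Suc n + 1 = 2 * n + 3" by simp_all
  ultimately show ?case by (simp only:)
qed

lemma sin_recurrence: "sin (real (k + 2) * x) = 2 * cos x * sin (real (k + 1) * x) - sin (real k * x)"
proof -
  have "sin (real (k + 1) * x + x) + sin (real (k + 1) * x - x) = 2 * cos x * sin (real (k + 1) * x)"
    by (simp add: sin_add sin_diff)
  then show ?thesis by (simp add: algebra_simps)
qed

lemma sin_angle_pos:
  assumes "s \<in> S" "t \<in> S" "s \<noteq> t" "m s t = enat n"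
  shows "sin (pi / n) > 0"
proof (rule sin_gt_zero)
  have "enat 2 \<le> enat n" using m_ge_2[OF assms(1-3)] assms(4) by (simp add: numeral_eq_enat)
  then show "0 < pi / n" "pi / n < pi" by (simp_all add: divide_less_eq)
qed

lemma act_relator:
  assumes "R \<in> relators S m"
  shows "act R v = v"
proof -
  consider s where "R = [s, s]"
    | s t n where "s \<in> S" "t \<in> S" "s \<noteq> t" "m s t = enat n" "R = alt (2 * n) s t"
    using assms unfolding relators_def alt_even by blast
  then show ?thesis
  proof cases
    case 1
    then show ?thesis by (simp add: reflect_involution)
  next
    case 2
    define x where "x = pi / n"
    have sin: "sin x > 0" using sin_angle_pos[OF 2(1-4)] by (simp add: x_def)
    then have "n \<noteq> 0" by (cases "n = 0") (auto simp: x_def)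
    then have nx: "real n * x = pi" by (simp add: x_def)
    define c where "c = bond_weight s t"
    have c: "c = 2 * cos x" using 2 by (simp add: c_def bond_weight_def x_def)
    have "4 - c\<^sup>2 = 4 * (sin x)\<^sup>2" by (simp add: c sin_squared_eq algebra_simps)
    then have det: "4 - c\<^sup>2 \<noteq> 0" using sin by simp
    define A where "A = (\<Sum>u\<in>S - {s, t}. bond_weight s u * v u)"
    define B where "B = (\<Sum>u\<in>S - {s, t}. bond_weight t u * v u)"
    \<comment> \<open>The fixed point by Cramer's rule; the determinant \<open>4 - c^2\<close> is
      \<open>4 (sin x)^2\<close>.\<close>
    define P where "P = (2 * A + c * B) / (4 - c\<^sup>2)"
    define Q where "Q = (2 * B + c * A) / (4 - c\<^sup>2)"
    have PQ: "2 * P = c * Q + A" "2 * Q = c * P + B"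
      using det by (simp_all add: P_def Q_def field_simps power2_eq_square)
    \<comment> \<open>The solution of the recurrence with \<open>h 0 = v s - P\<close> and
      \<open>h 1 = v t - Q\<close>; it has period \<open>2 * n\<close> since
      \<open>n x = pi\<close>.\<close>
    define h where "h k = ((v t - Q) * sin (real k * x) - (v s - P) * sin (real k * x - x)) / sin x" for k
    have "sin (real (k + 2) * x - x) = c * sin (real (k + 1) * x - x) - sin (real k * x - x)" for k
    proof -
      have "sin (real k * x + x) + sin (real k * x - x) = c * sin (real k * x)"
        by (simp add: c sin_add sin_diff)
      then show ?thesis by (simp add: algebra_simps)
    qed
    moreover have "(\<alpha> * (c * a1 - a0) - \<beta> * (c * b1 - b0)) / d = c * ((\<alpha> * a1 - \<beta> * b1) / d) - (\<alpha> * a0 - \<beta> * b0) / d"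
      for \<alpha> \<beta> a0 a1 b0 b1 d :: real
      by (simp add: diff_divide_distrib add_divide_distrib algebra_simps)
    ultimately have "h (k + 2) = c * h (k + 1) - h k" for k
      unfolding h_def sin_recurrence c[symmetric] by presburger
    moreover have "v s = h 0 + P" "v t = h 1 + Q" using sin by (simp_all add: h_def)
    ultimately have "act (alt (2 * n) s t) v = v(s := h (2 * n) + P, t := h (2 * n + 1) + Q)"
      using 2 PQ by (intro act_dihedral) (simp_all add: c_def A_def B_def)
    moreover have "h (2 * n) = h 0" "h (2 * n + 1) = h 1"
    proof -
      have turn: "real (2 * n) * x = 2 * pi" "real (2 * n + 1) * x = x + 2 * pi"
        using nx by (simp_all add: algebra_simps)
      show "h (2 * n) = h 0" "h (2 * n + 1) = h 1"
        unfolding h_def turn by simp_all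
    qed
    ultimately show ?thesis using 2 \<open>v s = h 0 + P\<close> \<open>v t = h 1 + Q\<close> by auto
  qed
qed

lemma act_equiv: "u \<approx> w \<Longrightarrow> act u v = act w v"
  by (induction rule: cox_eq.induct) (auto simp: act_append act_relator)

text \<open>Acting on the simple root of \<open>t\<close>, where the fixed point is the origin,
  gives the coordinates \<open>sin (k x) / sin x\<close> with \<open>x = pi / n\<close>, or simply
  \<open>k\<close> for infinite order. A return to the start after \<open>2 * p\<close> steps forces
  \<open>n\<close> to divide \<open>p\<close>, and is impossible in the infinite case.\<close>

lemma order_exact:
  assumes st: "s \<in> S" "t \<in> S" "s \<noteq> t" and "p > 0" and trivial: "alt (2 * p) s t \<approx> []"
  shows "m s t \<le> enat p"
proof -
  define v :: "'a \<Rightarrow> real" where "v = (\<lambda>_. 0)(t := 1)"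
  have v: "v s = 0" "v t = 1" and sum0: "(\<Sum>u\<in>S - {s, t}. f u * v u) = 0" for f
    using st by (auto simp: v_def)
  have period: "h (2 * p) = 0 \<and> h (2 * p + 1) = 1"
    if "\<And>k. h (k + 2) = bond_weight s t * h (k + 1) - h k" "h 0 = 0" "h 1 = 1" for h :: "nat \<Rightarrow> real"
  proof -
    have "v = v(s := h (2 * p) + 0, t := h (2 * p + 1) + 0)"
      using act_dihedral[of s t h 0 0 v p] act_equiv[OF trivial, of v] st that sum0 v by simp
    from fun_cong[OF this, of s] fun_cong[OF this, of t] show ?thesis using st v by auto
  qed
  show ?thesis
  proof (cases "m s t")
    case (enat n)
    define x where "x = pi / n"
    have sin: "sin x > 0" using sin_angle_pos[OF st enat] by (simp add: x_def)
    then have n: "n \<noteq> 0" by (cases "n = 0") (auto simp: x_def)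
    define h where "h k = sin (real k * x) / sin x" for k
    have "h (2 * p) = 0 \<and> h (2 * p + 1) = 1"
    proof (rule period)
      show "h (k + 2) = bond_weight s t * h (k + 1) - h k" for k
        unfolding h_def sin_recurrence using enat by (simp add: bond_weight_def x_def diff_divide_distrib)
    qed (use sin in \<open>simp_all add: h_def\<close>)
    then have "sin (real (2 * p) * x) = 0" "sin (real (2 * p) * x + x) = sin x"
      using sin by (simp_all add: h_def algebra_simps)
    then have "cos (real (2 * p) * x) = 1" using sin by (simp add: sin_add)
    then obtain k :: int where "real (2 * p) * x = real_of_int k * 2 * pi"
      unfolding cos_one_2pi_int by blast
    then have "real p = real_of_int k * real n" using n by (simp add: x_def field_simps)
    then have "int p = k * int n" by (metis of_int_eq_iff of_int_mult of_int_of_nat_eq)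
    then have "n \<le> p" using \<open>p > 0\<close>
      by (metis dvd_triv_right int_dvd_int_iff dvd_imp_le)
    then show ?thesis using enat by simp
  next
    case infinity
    have "real (2 * p) = 0 \<and> real (2 * p + 1) = 1"
      by (rule period[of real]) (use infinity in \<open>simp_all add: bond_weight_def\<close>)
    then show ?thesis using \<open>p > 0\<close> by simp
  qed
qed

section \<open>Braids and words with two left descents\<close>

lemma equiv_braid:
  assumes "s \<in> S" "t \<in> S" "s \<noteq> t" "m s t = enat n"
  shows "alt n s t \<approx> alt n t s"
proof -
  have "alt n s t @ rev (alt n t s) = alt (2 * n) s t"
    using alt_add[of n n s t] by (simp add: rev_alt mult_2)
  then have "alt n s t @ rev (alt n t s) @ alt n t s \<approx> alt n t s"
    using equiv_relator[OF alt_relator[OF assms], of "[]" "alt n t s"] by (metis append_Nil append_assoc)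
  moreover have "set (alt n t s) \<subseteq> S" using set_alt[of n t s] assms by auto
  then have "alt n s t @ rev (alt n t s) @ alt n t s \<approx> alt n s t @ []"
    using equiv_rev_cancel'[of "alt n t s" "[]"] by (intro equiv_append cox_eq.refl) simp
  ultimately show ?thesis by (metis append_Nil2 equiv_sym equiv_trans)
qed

lemma comm_imp_equiv: "u \<sim> v \<Longrightarrow> u \<approx> v"
proof (induction rule: comm_induct)
  case (swap p s t q)
  then have "alt 2 t s \<approx> alt 2 s t"
    using indep_sym[OF swap(2)] by (intro equiv_braid) (auto simp: indep_def numeral_eq_enat)
  then have "p @ [t, s] @ q \<approx> p @ [s, t] @ q"
    by (intro equiv_context) (simp add: numeral_2_eq_2)
  then show ?case using swap(3) by (rule equiv_trans)
qed (rule cox_eq.refl)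

text \<open>Left multiplication by \<open>t\<close> deletes one letter. If it were in the
  alternating prefix, \<open>t\<close> would equal some \<open>alt (2 * j + 1) s t\<close> with
  \<open>j < k\<close>, making the order of \<open>t s\<close> at most \<open>k\<close>. So the
  letter lies in \<open>x\<close>, and \<open>t\<close> extends the prefix.\<close>

lemma alternating_prefix_step:
  assumes w: "minimal w" and st: "s \<in> S" "t \<in> S" "s \<noteq> t"
    and x: "w \<approx> alt k s t @ x" "k + length x = length w"
    and t: "w \<approx> t # b" "length b < length w" and k: "enat k < m s t"
  shows "\<exists>x'. w \<approx> alt (Suc k) t s @ x' \<and> Suc k + length x' = length w"
proof -
  let ?a = "alt k s t"
  have min: "minimal (?a @ x)" using minimal_length_eq[OF w x(1)] x(2) by simp
  have "t # ?a @ x \<approx> b"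
    using x(1) t(1) st(2) equiv_Cons_shift equiv_sym equiv_trans by meson
  then have "\<not> minimal (t # ?a @ x)" using t(2) x(2) by (auto simp: minimal_def)
  then have pos: "inversions (?a @ x) [t] > 0" using exchange[OF min st(2)] by simp
  have "\<not> alt (2 * j + 1) s t \<approx> [t]" if "j < k" for j
  proof
    assume "alt (2 * j + 1) s t \<approx> [t]"
    then have "t # alt (2 * j + 1) s t \<approx> []"
      using equiv_Cons[of _ "[t]" t] equiv_involution[OF st(2), of "[]"] equiv_trans by blast
    then have "m t s \<le> enat (Suc j)" using order_exact[of t s "Suc j"] st by simp
    also have "\<dots> \<le> enat k" using that by simp
    finally show False using k m_sym[OF st] by simp
  qed
  then have "inversions ?a [t] = 0" by (simp add: inversions_alt st)
  then have "inversions x (rev ?a @ [t] @ ?a) > 0" using pos by (simp add: inversions_append)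
  moreover have aS: "set ?a \<subseteq> S" and "set x \<subseteq> S" using minimal_set[OF min] by auto
  ultimately obtain p c q where pq: "x = p @ c # q" "(rev ?a @ [t] @ ?a) @ x \<approx> p @ q"
    using inversion_deletion by blast
  have "[t] @ ?a @ x \<approx> ?a @ rev ?a @ [t] @ ?a @ x"
    using equiv_sym[OF equiv_rev_cancel[OF aS]] by simp
  also have "\<dots> \<approx> ?a @ p @ q"
    using equiv_context[OF pq(2), of ?a "[]"] by simp
  finally have "?a @ x \<approx> t # ?a @ p @ q" using st(2) equiv_Cons_shift by simp
  then have "w \<approx> alt (Suc k) t s @ p @ q" using x(1) equiv_trans by simp
  then show ?thesis using x(2) pq(1) by (intro exI[of _ "p @ q"]) simp
qed

lemma two_descents:
  assumes w: "minimal w" and st: "s \<in> S" "t \<in> S" "s \<noteq> t"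
    and s: "w \<approx> s # a" "Suc (length a) = length w"
    and t: "w \<approx> t # b" "Suc (length b) = length w"
  obtains n x where "m s t = enat n" "w \<approx> alt n s t @ x" "n + length x = length w"
proof -
  \<comment> \<open>The prefix grows at its front and always ends in \<open>s\<close>, so its first
    letter depends on the parity of \<open>k\<close>. Its length is bounded by that of
    \<open>w\<close>, which excludes infinite order.\<close>
  have prefix: "\<exists>x. w \<approx> (if odd k then alt k s t else alt k t s) @ x \<and> k + length x = length w"
    if "k > 0" "enat k \<le> m s t" for k
    using that
  proof (induction k)
    case (Suc k)
    show ?case
    proof (cases "k = 0")
      case True
      then show ?thesis using s by (intro exI[of _ a]) simp
    next
      case False
      have less: "enat k < m s t" using Suc.prems(2) by (cases "m s t") auto
      then obtain x where x: "w \<approx> (if odd k then alt k s t else alt k t s) @ x" "k + length x = length w"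
        using Suc False by (auto simp: less_imp_le)
      show ?thesis
      proof (cases "odd k")
        case True
        then show ?thesis using alternating_prefix_step[OF w st _ x(2) t(1) _ less] x(1) t(2) by simp
      next
        case False
        then show ?thesis
          using alternating_prefix_step[OF w st(2,1) _ _ x(2) s(1)] x(1) s(2) st(3) less m_sym[OF st] by auto
      qed
    qed
  qed simp
  have "m s t \<noteq> \<infinity>"
  proof
    assume "m s t = \<infinity>"
    then show False using prefix[of "Suc (length w)"] by auto
  qed
  then obtain n where n: "m s t = enat n" by auto
  then have "n > 0" using m_ge_2[OF st] by (auto simp: numeral_eq_enat)
  then obtain x where x: "w \<approx> (if odd n then alt n s t else alt n t s) @ x" "n + length x = length w"
    using prefix[of n] n by auto
  have flip: "alt n t s @ x \<approx> alt n s t @ x"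
    using equiv_append[OF equiv_sym[OF equiv_braid[OF st n]] cox_eq.refl] .
  have "w \<approx> alt n s t @ x"
    using x(1) equiv_trans[OF _ flip, of w] by (cases "odd n") simp_all
  with n x(2) that show ?thesis by blast
qed

lemma fc_word_comm: "fc_word w \<Longrightarrow> w \<sim> v \<Longrightarrow> fc_word v"
  unfolding fc_word_def using comm_trans comm_set by metis

lemma fc_word_tl:
  assumes "fc_word (s # w)"
  shows "fc_word w"
  unfolding fc_word_def
proof (intro conjI allI impI)
  show "set w \<subseteq> S" using assms by (simp add: fc_word_def)
  fix x b y assume "w \<sim> x @ b @ y"
  then have "s # w \<sim> (s # x) @ b @ y" using comm_Cons by simp
  then show "b \<notin> forbidden" using assms unfolding fc_word_def by blast
qed

text \<open>Stembridge's criterion. If \<open>w\<close> starts with \<open>s\<close> and an equivalent reduced word starts with \<open>t\<close>, then \<open>w\<close> is equivalent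
  to a reduced word with a braid as prefix; by the induction hypothesis commutations suffice to
  reach that word, so the braid has length two.\<close>

lemma fc_word_minimal_comm:
  assumes "fc_word w"
  shows "minimal w \<and> (\<forall>v. w \<approx> v \<longrightarrow> length v = length w \<longrightarrow> w \<sim> v)"
  using assms
proof (induction w rule: length_induct)
  case (1 w)
  note IH = 1(1)[rule_format]
  show ?case
  proof (cases w)
    case Nil
    then show ?thesis by (auto simp: minimal_def comm_eq.refl)
  next
    case (Cons s w')
    have w': "fc_word w'" using 1(2) Cons fc_word_tl by simp
    then have min': "minimal w'" and comm': "\<And>v. w' \<approx> v \<Longrightarrow> length v = length w' \<Longrightarrow> w' \<sim> v"
      using IH[of w'] Cons by auto
    have wS: "set w \<subseteq> S" and s: "s \<in> S" using 1(2) Cons by (auto simp: fc_word_def)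
    \<comment> \<open>A deletion in \<open>w'\<close> gives a word \<open>s # u @ v\<close> of equal
      length for the same element, so commutations turn \<open>w\<close> into a word starting with
      \<open>s s\<close>.\<close>
    have min: "minimal w"
    proof (rule ccontr)
      assume "\<not> minimal w"
      then have "inversions w' [s] > 0" using exchange[OF min' s] Cons by simp
      then obtain u a v where uv: "w' = u @ a # v" "s # w' \<approx> u @ v"
        using inversion_deletion[of w' "[s]"] minimal_set[OF min'] by auto
      then have "w' \<sim> s # u @ v" using comm' s equiv_Cons_shift by simp
      then have "w \<sim> [] @ [s, s] @ u @ v" using Cons comm_Cons by simp
      then show False using 1(2) s unfolding fc_word_def forbidden_def by blast
    qed
    have "w \<sim> v" if v: "w \<approx> v" "length v = length w" for v
    proof -
      obtain t v' where tv: "v = t # v'" using v(2) Cons by (cases v) auto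
      have t: "t \<in> S" using equiv_set[OF v(1)] wS tv by simp
      show ?thesis
      proof (cases "s = t")
        case True
        then have "w' \<sim> v'" using comm' v Cons tv s equiv_Cons_iff by simp
        then show ?thesis using Cons tv True comm_Cons by simp
      next
        case False
        have "w \<approx> s # w'" using Cons by (simp add: cox_eq.refl)
        then obtain n x where n: "m s t = enat n" and x: "w \<approx> alt n s t @ x" "n + length x = length w"
          by (rule two_descents[OF min s t False _ _ v(1)[unfolded tv]]) (use Cons v(2) tv in auto)
        have "2 \<le> n" using m_ge_2[OF s t False] n by (simp add: numeral_eq_enat)
        then obtain k where k: "n = Suc k" by (cases n) auto
        then have "s # w' \<approx> s # alt k t s @ x" using x(1) Cons by simp
        then have "w' \<sim> alt k t s @ x" using comm' s equiv_Cons_iff x(2) k Cons by simp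
        then have wx: "w \<sim> [] @ alt n s t @ x" using Cons comm_Cons k by simp
        then have "alt n s t \<notin> forbidden" using 1(2) unfolding fc_word_def by blast
        then have n2: "n = 2" using s t False n by (auto simp: forbidden_def)
        then have st: "indep s t" using n s t False by (simp add: indep_def numeral_eq_enat)
        have "w \<sim> [] @ [s, t] @ x" using wx n2 by (simp add: numeral_2_eq_2)
        also have "\<dots> \<sim> [] @ [t, s] @ x" using st by (rule comm_swap)
        finally have w_t: "w \<sim> t # s # x" by simp
        \<comment> \<open>Being a tail of a word in the class of \<open>w\<close>, it is covered by
          the induction hypothesis a second time.\<close>
        then have "fc_word (s # x)" using 1(2) fc_word_comm fc_word_tl by blast
        moreover have "s # x \<approx> v'"
          using comm_imp_equiv[OF w_t] v(1) tv t equiv_Cons_iff equiv_sym equiv_trans by metis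
        moreover have "length (s # x) < length w" "length v' = length (s # x)"
          using x(2) n2 v(2) tv by auto
        ultimately have "s # x \<sim> v'" using IH by blast
        then show ?thesis using w_t tv comm_Cons comm_trans by metis
      qed
    qed
    then show ?thesis using min by blast
  qed
qed

text \<open>Dependent letters never pass each other, so the projection onto two of them is an
  invariant of the class.\<close>

lemma comm_filter:
  assumes "u \<sim> v" "\<not> indep s t"
  shows "filter (\<lambda>x. x = s \<or> x = t) u = filter (\<lambda>x. x = s \<or> x = t) v"
  using assms(1)
proof (induction rule: comm_induct)
  case (swap p a b q)
  then have "a \<noteq> b" "\<not> (a = s \<and> b = t)" "\<not> (a = t \<and> b = s)"
    using assms(2) indep_sym[of t s] by (auto simp: indep_def)
  then show ?case using swap by auto
qed (rule HOL.refl)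

text \<open>A factor \<open>s s\<close> contradicts minimality. Flipping a longer braid would have
  to be achievable by commutations, but it changes the projection onto the dependent letters
  \<open>s\<close> and \<open>t\<close>.\<close>

lemma minimal_comm_imp_fc_word:
  assumes min: "minimal w" and comm: "\<And>v. w \<approx> v \<Longrightarrow> length v = length w \<Longrightarrow> w \<sim> v"
  shows "fc_word w"
  unfolding fc_word_def
proof (intro conjI allI impI notI)
  show "set w \<subseteq> S" using min by (rule minimal_set)
  fix x b y assume w: "w \<sim> x @ b @ y" and "b \<in> forbidden"
  then consider s where "s \<in> S" "b = [s, s]"
    | s t n where "s \<in> S" "t \<in> S" "s \<noteq> t" "m s t = enat n" "n \<noteq> 2" "b = alt n s t"
    by (auto simp: forbidden_def)
  then show False
  proof cases
    case 1
    have "x @ [s, s] @ y \<approx> x @ y"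
      using equiv_append[OF cox_eq.refl equiv_involution[OF 1(1), of y], of x] by simp
    then have "w \<approx> x @ y" using comm_imp_equiv[OF w] 1(2) equiv_trans by blast
    then show False using min comm_length[OF w] 1(2) by (auto simp: minimal_def)
  next
    case 2
    have "x @ b @ y \<approx> x @ alt n t s @ y"
      unfolding 2(6) using 2(1-4) by (intro equiv_context equiv_braid)
    then have "w \<approx> x @ alt n t s @ y" using comm_imp_equiv[OF w] equiv_trans by blast
    then have "w \<sim> x @ alt n t s @ y" using comm comm_length[OF w] 2(6) by simp
    then have braid: "x @ alt n s t @ y \<sim> x @ alt n t s @ y" using w 2(6) comm_sym comm_trans by blast
    have "\<not> indep s t" using 2(4,5) by (auto simp: indep_def numeral_eq_enat)
    moreover have "filter (\<lambda>x. x = s \<or> x = t) (alt n s t) = alt n s t"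
      "filter (\<lambda>x. x = s \<or> x = t) (alt n t s) = alt n t s"
      using set_alt[of n s t] set_alt[of n t s] by (auto intro!: filter_True)
    ultimately have "alt n s t = alt n t s" using comm_filter[OF braid, of s t] by simp
    moreover have "n \<noteq> 0" using m_ge_2[OF 2(1-3)] 2(4) by (auto simp: numeral_eq_enat)
    ultimately show False using 2(3) by (cases n) auto
  qed
qed

section \<open>From words back to group elements\<close>

lemma cox_length_elem:
  assumes "minimal w"
  shows "cox_length (cox_elem S m w) = length w"
  unfolding cox_length_def
proof (rule Least_equality)
  show "\<exists>v\<in>cox_elem S m w. length v = length w"
    using minimal_set[OF assms] by (intro bexI[of _ w]) (auto simp: cox_elem_def cox_eq.refl)
qed (use assms in \<open>auto simp: cox_elem_def minimal_def\<close>)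

lemma cox_elem_eq: "w \<approx> v \<Longrightarrow> cox_elem S m w = cox_elem S m v"
  unfolding cox_elem_def using equiv_sym equiv_trans by blast

lemma red_words_elem:
  assumes "minimal w"
  shows "red_words (cox_elem S m w) = {v. w \<approx> v \<and> length v = length w}"
  unfolding red_words_def cox_length_elem[OF assms]
  using equiv_set minimal_set[OF assms] by (auto simp: cox_elem_def)

lemma reduced_iff_minimal: "reduced S m w \<longleftrightarrow> minimal w"
proof
  assume red: "reduced S m w"
  then have w: "set w \<subseteq> S" by (simp add: reduced_def)
  then obtain v where v: "w \<approx> v" "minimal v" using exists_minimal by blast
  then have "length w = length v"
    using red cox_elem_eq[OF v(1)] red_words_elem[OF v(2)] by (simp add: reduced_def)
  then show "minimal w" using minimal_length_eq[OF v(2) equiv_sym[OF v(1)]] by simp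
next
  assume "minimal w"
  then show "reduced S m w"
    by (simp add: reduced_def red_words_elem minimal_set cox_eq.refl)
qed

lemma fc_word_iff: "fc_word w \<longleftrightarrow> reduced S m w \<and> fully_commutative S m (cox_elem S m w)"
proof
  assume fc: "fc_word w"
  then have w: "minimal w" "\<And>v. w \<approx> v \<Longrightarrow> length v = length w \<Longrightarrow> w \<sim> v"
    using fc_word_minimal_comm by auto
  have "fully_commutative S m (cox_elem S m w)"
    unfolding fully_commutative_def red_words_elem[OF w(1)]
  proof (intro conjI ballI)
    show "cox_elem S m w \<in> cox_group S m" using minimal_set[OF w(1)] by (auto simp: cox_group_def)
    show "u \<sim> v" if "u \<in> {v. w \<approx> v \<and> length v = length w}" "v \<in> {v. w \<approx> v \<and> length v = length w}" for u v
      using that w(2)[of u] w(2)[of v] comm_sym comm_trans by blast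
  qed
  then show "reduced S m w \<and> fully_commutative S m (cox_elem S m w)"
    using w(1) by (simp add: reduced_iff_minimal)
next
  assume "reduced S m w \<and> fully_commutative S m (cox_elem S m w)"
  then have w: "minimal w" and "fully_commutative S m (cox_elem S m w)"
    by (auto simp: reduced_iff_minimal)
  then have "w \<sim> v" if "w \<approx> v" "length v = length w" for v
    using that cox_eq.refl unfolding fully_commutative_def red_words_elem[OF w] by blast
  with w show "fc_word w" by (rule minimal_comm_imp_fc_word)
qed

text \<open>Needed because the cyclic condition is vacuous for the empty word: there is no
  \<open>k < length w\<close>. The bound \<open>2 \<le> m s t\<close> keeps \<open>alt 0 s t\<close>
  out of \<open>forbidden\<close>.\<close>

lemma fc_word_Nil: "fc_word []"
proof -
  have "[] \<notin> forbidden"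
  proof
    assume "[] \<in> forbidden"
    then obtain s t n where "s \<in> S" "t \<in> S" "s \<noteq> t" "m s t = enat n" "alt n s t = []"
      unfolding forbidden_def by auto
    then show False using m_ge_2[of s t] length_alt[of n s t] by (simp add: numeral_eq_enat)
  qed
  moreover have "b = []" if "[] \<sim> x @ b @ y" for x b y
    using comm_length[OF that] by simp
  ultimately show ?thesis unfolding fc_word_def by auto
qed

lemma cfc_word_fc_word: "cfc_word w \<Longrightarrow> fc_word w"
  by (metis append_Nil append_Nil2 cfc_word_def comm_eq.refl)

lemma cyc_fully_commutative_elem:
  assumes "cfc_word w"
  shows "cyc_fully_commutative S m (cox_elem S m w)"
  unfolding cyc_fully_commutative_def
proof (intro conjI ballI allI impI)
  have w: "minimal w" "\<And>v. w \<approx> v \<Longrightarrow> length v = length w \<Longrightarrow> w \<sim> v"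
    using fc_word_minimal_comm[OF cfc_word_fc_word[OF assms]] by auto
  show "cox_elem S m w \<in> cox_group S m" using minimal_set[OF w(1)] by (auto simp: cox_group_def)
  fix v k assume "v \<in> red_words (cox_elem S m w)" "k < length v"
  then have "w \<sim> take k v @ drop k v" using w by (simp add: red_words_elem)
  then have "fc_word (drop k v @ take k v)" using assms by (simp add: cfc_word_def)
  then have "fc_word (rotate k v)" using \<open>k < length v\<close> by (simp add: rotate_drop_take)
  then show "reduced S m (rotate k v)" "fully_commutative S m (cox_elem S m (rotate k v))"
    by (auto simp: fc_word_iff)
qed

lemma cyc_fully_commutative_word:
  assumes "cyc_fully_commutative S m X"
  obtains w where "cfc_word w" "normal w" "X = cox_elem S m w"
proof -
  obtain w0 where "set w0 \<subseteq> S" "X = cox_elem S m w0"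
    using assms by (auto simp: cyc_fully_commutative_def cox_group_def)
  then obtain w1 where w1: "minimal w1" "X = cox_elem S m w1"
    using exists_minimal[of w0] cox_elem_eq[of w0] by blast
  obtain w where w: "w1 \<sim> w" "normal w" using exists_normal by blast
  have X: "X = cox_elem S m w" using w1(2) cox_elem_eq[OF comm_imp_equiv[OF w(1)]] by simp
  have min: "minimal w"
    using minimal_length_eq[OF w1(1) comm_imp_equiv[OF w(1)]] comm_length[OF w(1)] by simp
  have "cfc_word w"
    unfolding cfc_word_def
  proof (intro conjI allI impI)
    show "set w \<subseteq> S" using min by (rule minimal_set)
    fix u v assume uv: "w \<sim> u @ v"
    then have mem: "u @ v \<in> red_words X"
      unfolding X red_words_elem[OF min] using comm_imp_equiv[OF uv] comm_length[OF uv] by simp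
    show "fc_word (v @ u)"
    \<comment> \<open>For \<open>v = []\<close> the split would be a rotation by the full length,
      outside the range of \<open>k\<close>; \<open>k = 0\<close> gives the same word unless it is
      empty.\<close>
    proof (cases "v = []")
      case False
      then have "length u < length (u @ v)" by simp
      then have "reduced S m (rotate (length u) (u @ v))
          \<and> fully_commutative S m (cox_elem S m (rotate (length u) (u @ v)))"
        using assms mem unfolding cyc_fully_commutative_def by blast
      then show ?thesis by (simp add: rotate_append fc_word_iff)
    next
      case v: True
      show ?thesis
      proof (cases "u = []")
        case True
        then show ?thesis using v fc_word_Nil by simp
      next
        case False
        then have "reduced S m (rotate 0 (u @ v)) \<and> fully_commutative S m (cox_elem S m (rotate 0 (u @ v)))"
          using assms mem unfolding cyc_fully_commutative_def by (metis append_is_Nil_conv length_greater_0_conv)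
        then show ?thesis using v by (simp add: fc_word_iff)
      qed
    qed
  qed
  with w(2) X that show ?thesis by blast
qed

text \<open>The reduced words of a CFC element form a single commutation class, which contains
  exactly one normal word.\<close>

lemma card_CFC: "card (CFC_k S m k) = card {w \<in> {w. cfc_word w} \<inter> {w. normal w}. set w \<subseteq> S \<and> length w = k}"
    (is "_ = card ?N")
proof -
  have length: "cox_length (cox_elem S m w) = length w" if "cfc_word w" for w
    using cox_length_elem fc_word_minimal_comm[OF cfc_word_fc_word[OF that]] by blast
  have inj: "inj_on (cox_elem S m) ?N"
  proof (rule inj_onI)
    fix w v assume w: "w \<in> ?N" and v: "v \<in> ?N" and eq: "cox_elem S m w = cox_elem S m v"
    have "v \<in> cox_elem S m v" using v by (simp add: cox_elem_def cox_eq.refl)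
    then have "w \<approx> v" unfolding eq[symmetric] by (simp add: cox_elem_def)
    then have "w \<sim> v" using fc_word_minimal_comm[OF cfc_word_fc_word, of w] w v by simp
    then show "w = v" using normal_unique w v by simp
  qed
  have image: "cox_elem S m ` ?N = CFC_k S m k"
  proof (intro equalityI subsetI)
    fix X assume "X \<in> CFC_k S m k"
    then have X: "cyc_fully_commutative S m X" "cox_length X = k" by (auto simp: CFC_k_def)
    from X(1) obtain w where w: "cfc_word w" "normal w" "X = cox_elem S m w"
      by (rule cyc_fully_commutative_word)
    then have "w \<in> ?N" using X(2) length by (auto simp: cfc_word_def)
    then show "X \<in> cox_elem S m ` ?N" using w(3) by blast
  qed (use length cyc_fully_commutative_elem in \<open>auto simp: CFC_k_def\<close>)
  show ?thesis using card_image[OF inj] unfolding image .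
qed

end

theorem theorem1:
  fixes S :: "'a set" and m :: "'a \<Rightarrow> 'a \<Rightarrow> enat"
  assumes "coxeter_system S m"
  shows "\<exists>p q :: rat poly. q \<noteq> 0 \<and>
           fps_of_poly q * Abs_fps (\<lambda>k. of_nat (card (CFC_k S m k))) = fps_of_poly p"
proof -
  interpret coxeter S m using assms by (rule coxeter.intro)
  show ?thesis
    unfolding card_CFC
    by (rule regular_imp_rational_count[OF finite_S regular_Int[OF regular_cfc_word regular_normal]])
qed

end
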